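(* Let $n\ge2$ and suppose physically separated agents $A_1,\dots,A_n$ share a multipartite pure quantum state $|\psi\rangle\in\mathcal{H}_1\otimes\cdots\otimes\mathcal{H}_n$ (each $\mathcal{H}_i$ a finite-dimensional complex Hilbert space), where agent $A_i$ holds the particle in $\mathcal{H}_i$. Suppose communication between the agents, classical or quantum, is unreliable and local ancillary quantum systems are forbidden. Then there exists a totally correct protocol for these agents to reach a consensus if and only if $|\psi\rangle$ is locally undetermined (equivalently, $|\psi\rangle$ is GSD).
   Context: All Hilbert spaces are complex and finite-dimensional; a pure state is a unit vector, and vectors differing by a global phase represent the same state. Operators on $\mathcal{H}_i$ are extended to the tensor product by tensoring with identities; $\mathrm{Tr}_i$ is the partial trace over $\mathcal{H}_i$; "projector" means orthogonal projection operator. Protocol model. Since communication is unreliable, no communication and no classical post-processing is used, and since ancillas are forbidden each agent acts only on its own particle. A protocol thus consists of a finite set $J$ of labels (possible consensus values) and, for each agent $A_i$, a projective measurement $\{Q_j^i : j\in J\}$ on $\mathcal{H}_i$ (pairwise orthogonal projectors, possibly zero, with $\sum_{j\in J}Q_j^i=I_{\mathcal{H}_i}$); agent $A_i$ measures its particle and announces the outcome as its decision. The agents need not use the same measurements (the network need not be anonymous). The protocol is a totally correct protocol to reach a consensus if, on every computation path (every joint outcome of nonzero probability), all agents announce the same value, i.e. $\bigotimes_{i=1}^n Q_{j_i}^i|\psi\rangle=0$ unless $j_1=\dots=j_n$, and the consensus is nontrivial, i.e. at least two different values $j\in J$ occur with nonzero probability. $|\psi\rangle$ is locally undetermined if there exists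 a pure state $|\phi\rangle\in\mathcal{H}_1\otimes\cdots\otimes\mathcal{H}_n$ with $|\langle\phi|\psi\rangle|\ne1$ and $\mathrm{Tr}_i|\psi\rangle\langle\psi|=\mathrm{Tr}_i|\phi\rangle\langle\phi|$ for all $i=1,\dots,n$. $|\psi\rangle$ is generalized Schmidt decomposable (GSD) if there are $L>1$ and projectors $P_j^i$ on $\mathcal{H}_i$ ($1\le i\le n$, $1\le j\le L$) such that for each $i$ the $P_1^i,\dots,P_L^i$ are pairwise orthogonal, $P_j^i|\psi\rangle\ne0$ for all $i,j$, and $|\psi\rangle=\sum_{j=1}^L\bigotimes_{i=1}^nP_j^i|\psi\rangle$. *)

theory Defs
  imports Complex_Main "HOL-Library.FuncSet" "Jordan_Normal_Form.Schur_Decomposition"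
begin

(* The particle i in the index set I has state space C^(d i), operators on it being the
   (d i) x (d i) complex matrices.  The product basis of the tensor product of these spaces
   over I is indexed by multi-indices k with k i < d i for i in I.  Vectors and operators on
   the tensor product are coefficient functions vanishing outside the multi-indices, so that
   equality of functions is equality of vectors or operators. *)

type_synonym multi_index = "nat \<Rightarrow> nat"
type_synonym tvec = "multi_index \<Rightarrow> complex"
type_synonym tmat = "multi_index \<Rightarrow> multi_index \<Rightarrow> complex"

definition multi_indices :: "nat set \<Rightarrow> (nat \<Rightarrow> nat) \<Rightarrow> multi_index set" where
  "multi_indices I d = (\<Pi>\<^sub>E i\<in>I. {..<d i})"

definition tensor_space :: "nat set \<Rightarrow> (nat \<Rightarrow> nat) \<Rightarrow> tvec set" where
  "tensor_space I d = {\<psi>. \<forall>k. k \<notin> multi_indices I d \<longrightarrow> \<psi> k = 0}"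

definition tinner :: "nat set \<Rightarrow> (nat \<Rightarrow> nat) \<Rightarrow> tvec \<Rightarrow> tvec \<Rightarrow> complex" where
  "tinner I d \<phi> \<psi> = (\<Sum>k\<in>multi_indices I d. cnj (\<phi> k) * \<psi> k)"

definition tnorm :: "nat set \<Rightarrow> (nat \<Rightarrow> nat) \<Rightarrow> tvec \<Rightarrow> real" where
  "tnorm I d \<psi> = sqrt (\<Sum>k\<in>multi_indices I d. (cmod (\<psi> k))\<^sup>2)"

definition pure_state :: "nat set \<Rightarrow> (nat \<Rightarrow> nat) \<Rightarrow> tvec \<Rightarrow> bool" where
  "pure_state I d \<psi> \<longleftrightarrow> \<psi> \<in> tensor_space I d \<and> tnorm I d \<psi> = 1"

definition ketbra :: "tvec \<Rightarrow> tvec \<Rightarrow> tmat" where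
  "ketbra \<psi> \<phi> = (\<lambda>k l. \<psi> k * cnj (\<phi> l))"

text \<open>The partial trace over particle \<open>i \<in> I\<close>; the result is an operator on the
  tensor product over \<open>I - {i}\<close>.\<close>

definition partial_trace :: "nat set \<Rightarrow> (nat \<Rightarrow> nat) \<Rightarrow> nat \<Rightarrow> tmat \<Rightarrow> tmat" where
  "partial_trace I d i R = (\<lambda>k l.
     if k \<in> multi_indices (I - {i}) d \<and> l \<in> multi_indices (I - {i}) d
     then (\<Sum>a<d i. R (k(i := a)) (l(i := a))) else 0)"

definition tensor_op :: "nat set \<Rightarrow> (nat \<Rightarrow> nat) \<Rightarrow> (nat \<Rightarrow> complex mat) \<Rightarrow> tmat" where
  "tensor_op I d A = (\<lambda>k l.
     if k \<in> multi_indices I d \<and> l \<in> multi_indices I d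
     then (\<Prod>i\<in>I. A i $$ (k i, l i)) else 0)"

definition local_op :: "nat set \<Rightarrow> (nat \<Rightarrow> nat) \<Rightarrow> nat \<Rightarrow> complex mat \<Rightarrow> tmat" where
  "local_op I d i A = tensor_op I d (\<lambda>m. if m = i then A else 1\<^sub>m (d m))"

definition op_apply :: "nat set \<Rightarrow> (nat \<Rightarrow> nat) \<Rightarrow> tmat \<Rightarrow> tvec \<Rightarrow> tvec" where
  "op_apply I d R \<psi> = (\<lambda>k. \<Sum>l\<in>multi_indices I d. R k l * \<psi> l)"

definition projector :: "nat \<Rightarrow> complex mat \<Rightarrow> bool" where
  "projector m P \<longleftrightarrow> P \<in> carrier_mat m m \<and> P * P = P \<and> mat_adjoint P = P"

definition pairwise_orthogonal :: "nat \<Rightarrow> 'j set \<Rightarrow> ('j \<Rightarrow> complex mat) \<Rightarrow> bool" where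
  "pairwise_orthogonal m J P \<longleftrightarrow> (\<forall>j\<in>J. \<forall>k\<in>J. j \<noteq> k \<longrightarrow> P j * P k = 0\<^sub>m m m)"

(* The completeness relation is stated entrywise, since the type of matrices of arbitrary
   dimensions is not an instance of comm_monoid_add. *)

definition projective_measurement :: "nat \<Rightarrow> 'j set \<Rightarrow> ('j \<Rightarrow> complex mat) \<Rightarrow> bool" where
  "projective_measurement m J Q \<longleftrightarrow>
     (\<forall>j\<in>J. projector m (Q j)) \<and> pairwise_orthogonal m J Q \<and>
     mat m m (\<lambda>(a, b). \<Sum>j\<in>J. Q j $$ (a, b)) = 1\<^sub>m m"

text \<open>\<open>Q i j\<close> is the projector of agent \<open>i\<close> for the announced value \<open>j\<close>.\<close>

definition protocol :: "nat set \<Rightarrow> (nat \<Rightarrow> nat) \<Rightarrow> 'j set \<Rightarrow> (nat \<Rightarrow> 'j \<Rightarrow> complex mat) \<Rightarrow> bool" where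
  "protocol I d J Q \<longleftrightarrow> finite J \<and> (\<forall>i\<in>I. projective_measurement (d i) J (Q i))"

definition outcome_prob ::
  "nat set \<Rightarrow> (nat \<Rightarrow> nat) \<Rightarrow> (nat \<Rightarrow> 'j \<Rightarrow> complex mat) \<Rightarrow> tvec \<Rightarrow> (nat \<Rightarrow> 'j) \<Rightarrow> real" where
  "outcome_prob I d Q \<psi> s = (tnorm I d (op_apply I d (tensor_op I d (\<lambda>i. Q i (s i))) \<psi>))\<^sup>2"

definition totally_correct_consensus ::
  "nat set \<Rightarrow> (nat \<Rightarrow> nat) \<Rightarrow> tvec \<Rightarrow> 'j set \<Rightarrow> (nat \<Rightarrow> 'j \<Rightarrow> complex mat) \<Rightarrow> bool" where
  "totally_correct_consensus I d \<psi> J Q \<longleftrightarrow>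
     protocol I d J Q \<and>
     (\<forall>s \<in> I \<rightarrow>\<^sub>E J. outcome_prob I d Q \<psi> s \<noteq> 0 \<longrightarrow> (\<forall>i\<in>I. \<forall>m\<in>I. s i = s m)) \<and>
     (\<exists>j\<in>J. \<exists>k\<in>J. j \<noteq> k \<and>
        outcome_prob I d Q \<psi> (\<lambda>i\<in>I. j) \<noteq> 0 \<and> outcome_prob I d Q \<psi> (\<lambda>i\<in>I. k) \<noteq> 0)"

definition locally_undetermined :: "nat set \<Rightarrow> (nat \<Rightarrow> nat) \<Rightarrow> tvec \<Rightarrow> bool" where
  "locally_undetermined I d \<psi> \<longleftrightarrow>
     (\<exists>\<phi>. pure_state I d \<phi> \<and> cmod (tinner I d \<phi> \<psi>) \<noteq> 1 \<and>
        (\<forall>i\<in>I. partial_trace I d i (ketbra \<psi> \<psi>) = partial_trace I d i (ketbra \<phi> \<phi>)))"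

definition GSD :: "nat set \<Rightarrow> (nat \<Rightarrow> nat) \<Rightarrow> tvec \<Rightarrow> bool" where
  "GSD I d \<psi> \<longleftrightarrow>
     (\<exists>(L :: nat) (P :: nat \<Rightarrow> nat \<Rightarrow> complex mat). L > 1 \<and>
        (\<forall>i\<in>I. (\<forall>j\<in>{1..L}. projector (d i) (P i j)) \<and> pairwise_orthogonal (d i) {1..L} (P i)) \<and>
        (\<forall>i\<in>I. \<forall>j\<in>{1..L}. op_apply I d (local_op I d i (P i j)) \<psi> \<noteq> (\<lambda>k. 0)) \<and>
        \<psi> = (\<lambda>k. \<Sum>j\<in>{1..L}. op_apply I d (tensor_op I d (\<lambda>i. P i j)) \<psi> k))"

end

theory Submission
  imports Defs
begin

text \<open>
  All three properties of \<open>\<psi>\<close> are equivalent to the existence of local projectors \<open>P\<^sub>i\<close>, one for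
  each agent, that all map \<open>\<psi>\<close> to one and the same vector \<open>\<chi>\<close>, with \<open>\<chi> \<noteq> 0\<close> and \<open>\<chi> \<noteq> \<psi>\<close>.
  The consensus protocol measures \<open>{P\<^sub>i, 1 - P\<^sub>i}\<close>, the decomposition is \<open>\<psi> = \<chi> + (\<psi> - \<chi>)\<close>,
  and the state \<open>\<psi> - 2 \<chi>\<close> arises from \<open>\<psi>\<close> by a local unitary \<open>1 - 2 P\<^sub>i\<close> of any single agent,
  hence has the same partial traces.

  Conversely, let \<open>\<psi>\<close> and \<open>\<phi>\<close> have the same partial traces, and write them as matrices \<open>M\<close>, \<open>N\<close> from
  all other particles to particle \<open>i\<close>.  Equality of \<open>Tr\<^sub>i\<close> says \<open>M\<^sup>* M = N\<^sup>* N\<close>, and equality of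
  \<open>Tr\<^sub>m\<close> for another \<open>m\<close> gives \<open>M M\<^sup>* = N N\<^sup>*\<close>; hence \<open>\<phi> = W\<^sub>i \<psi>\<close> for a normal operator \<open>W\<^sub>i\<close> on
  particle \<open>i\<close>.  Operators of different particles commute, so \<open>p(W\<^sub>i) \<psi>\<close> does not depend on \<open>i\<close> for
  any polynomial \<open>p\<close>, and neither does \<open>P\<^sub>x \<psi>\<close> for the spectral projector \<open>P\<^sub>x\<close> of \<open>W\<^sub>i\<close> at \<open>x\<close>.
  If every \<open>P\<^sub>x \<psi>\<close> were \<open>0\<close> or \<open>\<psi>\<close>, then \<open>\<phi>\<close> would be a multiple of \<open>\<psi>\<close>.
\<close>

section \<open>Normal matrices and polynomials of a matrix\<close>

lemma mat_adjoint_carrier [simp]: "A \<in> carrier_mat n m \<Longrightarrow> mat_adjoint A \<in> carrier_mat m n"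
  by (auto simp: mat_adjoint_def mat_of_rows_def)

lemma dim_mat_adjoint [simp]: "dim_row (mat_adjoint A) = dim_col A" "dim_col (mat_adjoint A) = dim_row A"
  by (auto simp: mat_adjoint_def mat_of_rows_def)

lemma index_mat_adjoint [simp]:
  fixes A :: "complex mat"
  assumes "i < dim_col A" "j < dim_row A"
  shows "mat_adjoint A $$ (i, j) = cnj (A $$ (j, i))"
  using assms by (simp add: mat_adjoint_def mat_of_rows_def)

lemma mat_adjoint_adjoint [simp]:
  fixes A :: "complex mat"
  shows "mat_adjoint (mat_adjoint A) = A"
  by (rule eq_matI) auto

lemma mat_adjoint_mult:
  fixes A B :: "complex mat"
  assumes "A \<in> carrier_mat n m" "B \<in> carrier_mat m k"
  shows "mat_adjoint (A * B) = mat_adjoint B * mat_adjoint A"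
  using assms by (intro eq_matI) (auto simp: scalar_prod_def intro!: sum.cong)

lemma mat_adjoint_one [simp]: "mat_adjoint (1\<^sub>m n :: complex mat) = 1\<^sub>m n"
  by (rule eq_matI) auto

lemma mat_adjoint_zero [simp]: "mat_adjoint (0\<^sub>m n m :: complex mat) = 0\<^sub>m m n"
  by (rule eq_matI) auto

lemma mat_adjoint_minus:
  fixes A B :: "complex mat"
  assumes "A \<in> carrier_mat n m" "B \<in> carrier_mat n m"
  shows "mat_adjoint (A - B) = mat_adjoint A - mat_adjoint B"
  using assms by (intro eq_matI) auto

text \<open>The j-th diagonal entry of the product is the squared norm of the j-th column of
  \<open>A\<close>. This positivity is the source of the cancellation arguments for normal matrices
  below.\<close>

lemma mat_adjoint_mult_self_eq_0:
  fixes A :: "complex mat"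
  assumes A: "A \<in> carrier_mat n m" and 0: "mat_adjoint A * A = 0\<^sub>m m m"
  shows "A = 0\<^sub>m n m"
proof (rule eq_matI)
  fix i j assume ij: "i < dim_row (0\<^sub>m n m)" "j < dim_col (0\<^sub>m n m)"
  have "(\<Sum>k<n. (cmod (A $$ (k, j)))\<^sup>2) = Re ((mat_adjoint A * A) $$ (j, j))"
    using A ij by (simp add: scalar_prod_def complex_mult_cnj mult.commute lessThan_atLeast0 cmod_power2)
  also have "\<dots> = 0" using 0 ij by simp
  finally have "(cmod (A $$ (i, j)))\<^sup>2 = 0"
    using ij by (subst (asm) sum_nonneg_eq_0_iff) auto
  then show "A $$ (i, j) = 0\<^sub>m n m $$ (i, j)" using ij by simp
qed (use A in auto)

lemma minus_mat_eq_0D: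
  fixes X Y :: "complex mat"
  assumes "X \<in> carrier_mat n m" "Y \<in> carrier_mat n m" "X - Y = 0\<^sub>m n m"
  shows "X = Y"
proof (rule eq_matI)
  fix i j assume "i < dim_row Y" "j < dim_col Y"
  then show "X $$ (i, j) = Y $$ (i, j)"
    using arg_cong[OF assms(3), of "\<lambda>M. M $$ (i, j)"] assms(1,2) by simp
qed (use assms in auto)

section \<open>Normal matrices: cancellation and idempotents\<close>

definition normal_mat :: "complex mat \<Rightarrow> bool" where
  "normal_mat A \<longleftrightarrow> A * mat_adjoint A = mat_adjoint A * A"

text \<open>A normal \<open>X\<close> and its adjoint have the same kernel. Since \<open>X\<close>
  kills Z = X Y, so does its adjoint, and then Z^* Z = Y^* X^* Z vanishes.\<close>

lemma normal_mat_cancel: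
  assumes X: "X \<in> carrier_mat n n" and Y: "Y \<in> carrier_mat n n" and nor: "normal_mat X"
    and 0: "X * (X * Y) = 0\<^sub>m n n"
  shows "X * Y = 0\<^sub>m n n"
proof -
  note assoc = assoc_mult_mat[of _ n n _ n _ n] mult_carrier_mat[of _ n n _ n]
  let ?X = "mat_adjoint X" and ?Y = "mat_adjoint Y"
  define Z where "Z = X * Y"
  have Z: "Z \<in> carrier_mat n n" and aZ: "mat_adjoint Z = ?Y * ?X"
    using X Y by (auto simp: Z_def mat_adjoint_mult[of _ n n])
  have "mat_adjoint (?X * Z) * (?X * Z) = mat_adjoint Z * ((X * ?X) * Z)"
    using X Y Z by (simp add: mat_adjoint_mult[of _ n n _ n] assoc)
  also have "\<dots> = mat_adjoint Z * (?X * (X * Z))"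
    using X Y Z nor by (simp add: normal_mat_def assoc)
  also have "\<dots> = 0\<^sub>m n n" using 0 X Z carrier_matD[OF Y] by (simp add: Z_def)
  finally have "?X * Z = 0\<^sub>m n n"
    by (rule mat_adjoint_mult_self_eq_0[rotated])
      (use X Z in \<open>simp add: mult_carrier_mat[of _ n n _ n]\<close>)
  then have "mat_adjoint Z * Z = 0\<^sub>m n n"
    using X Z carrier_matD[OF Y] mat_adjoint_carrier[OF Y] by (simp add: aZ assoc)
  then show ?thesis using Z mat_adjoint_mult_self_eq_0[of Z n n] by (simp add: Z_def)
qed

text \<open>\<open>P\<close> kills 1 - P, so by normality its adjoint does too. This means P^* = P^*
  P, and the right-hand side is Hermitian.\<close>

lemma normal_idempotent_hermitian:
  assumes P: "P \<in> carrier_mat n n" and nor: "normal_mat P" and idem: "P * P = P"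
  shows "mat_adjoint P = P"
proof -
  note assoc = assoc_mult_mat[of _ n n _ n _ n] mult_carrier_mat[of _ n n _ n]
  let ?P = "mat_adjoint P"
  have c: "?P \<in> carrier_mat n n" using P by simp
  have 1: "P * (P * (1\<^sub>m n - P)) = 0\<^sub>m n n" "P * (1\<^sub>m n - P) = 0\<^sub>m n n"
    using P idem by (simp_all add: mult_minus_distrib_mat[of _ n n _ n])
  have "mat_adjoint (?P * (1\<^sub>m n - P)) * (?P * (1\<^sub>m n - P))
      = (mat_adjoint (1\<^sub>m n - P)) * ((P * ?P) * (1\<^sub>m n - P))"
    using P c minus_carrier_mat[OF P, of "1\<^sub>m n"] by (simp add: mat_adjoint_mult[of _ n n _ n] assoc)
  also have "\<dots> = (mat_adjoint (1\<^sub>m n - P)) * (?P * (P * (1\<^sub>m n - P)))"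
    using P c minus_carrier_mat[OF P, of "1\<^sub>m n"] nor by (simp add: normal_mat_def assoc)
  also have "\<dots> = 0\<^sub>m n n"
    unfolding 1 using P by simp
  finally have "?P * (1\<^sub>m n - P) = 0\<^sub>m n n"
    by (rule mat_adjoint_mult_self_eq_0[rotated])
      (use P minus_carrier_mat[OF P, of \<open>1\<^sub>m n\<close>] in \<open>simp add: mult_carrier_mat[of _ n n _ n] minus_carrier_mat\<close>)
  then have "?P - ?P * P = 0\<^sub>m n n"
    using P c by (simp add: mult_minus_distrib_mat[of _ n n _ n])
  then have "?P = ?P * P"
    by (rule minus_mat_eq_0D[OF c mult_carrier_mat[OF c P]])
  moreover have "mat_adjoint (?P * P) = ?P * P"
    using P c by (simp add: mat_adjoint_mult[of _ n n _ n])
  ultimately show ?thesis by (metis mat_adjoint_adjoint)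
qed

section \<open>Evaluation of polynomials at a square matrix\<close>

definition mat_poly :: "nat \<Rightarrow> complex mat \<Rightarrow> complex poly \<Rightarrow> complex mat" where
  "mat_poly n A p = fold_coeffs (\<lambda>c X. c \<cdot>\<^sub>m 1\<^sub>m n + A * X) p (0\<^sub>m n n)"

lemma mat_poly_0 [simp]: "mat_poly n A 0 = 0\<^sub>m n n"
  by (simp add: mat_poly_def)

lemma mat_poly_pCons:
  assumes "A \<in> carrier_mat n n"
  shows "mat_poly n A (pCons c p) = c \<cdot>\<^sub>m 1\<^sub>m n + A * mat_poly n A p"
  \<comment> \<open>The fold is Horner's scheme. \<open>pCons 0 0\<close> is the zero polynomial, on
    which the fold takes no step, so this case is checked separately.\<close>
  using assms by (cases "p = 0 \<and> c = 0") (auto simp: mat_poly_def intro!: eq_matI)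

lemma scalar_plus_add:
  fixes X Y :: "complex mat"
  assumes "X \<in> carrier_mat n n" "Y \<in> carrier_mat n n"
  shows "(a + b) \<cdot>\<^sub>m 1\<^sub>m n + (X + Y) = (a \<cdot>\<^sub>m 1\<^sub>m n + X) + (b \<cdot>\<^sub>m 1\<^sub>m n + Y)"
  using assms by (intro eq_matI) auto

lemma scalar_plus_smult:
  fixes X :: "complex mat"
  assumes "X \<in> carrier_mat n n"
  shows "(c * a) \<cdot>\<^sub>m 1\<^sub>m n + c \<cdot>\<^sub>m X = c \<cdot>\<^sub>m (a \<cdot>\<^sub>m 1\<^sub>m n + X)"
  using assms by (intro eq_matI) (auto simp: algebra_simps)

lemma zero_scalar_plus:
  fixes X :: "complex mat"
  assumes "X \<in> carrier_mat n n"
  shows "0 \<cdot>\<^sub>m 1\<^sub>m n + X = X"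
  using assms by (intro eq_matI) auto

lemma one_smult_mat: "1 \<cdot>\<^sub>m (X :: complex mat) = X"
  by (intro eq_matI) auto

lemma add_uminus_smult:
  fixes X Y :: "complex mat"
  assumes "X \<in> carrier_mat n m" "Y \<in> carrier_mat n m"
  shows "X + (- 1) \<cdot>\<^sub>m Y = X - Y"
  using assms by (intro eq_matI) auto

context
  fixes n :: nat and A :: "complex mat"
  assumes A [simp]: "A \<in> carrier_mat n n"
begin

lemma mat_poly_carrier [simp]: "mat_poly n A p \<in> carrier_mat n n"
  by (induction p) (auto simp: mat_poly_pCons mult_carrier_mat[of _ n n _ n])

lemma mult_mat_poly_carrier [simp]: "A * mat_poly n A p \<in> carrier_mat n n"
  by (rule mult_carrier_mat[of _ n n]) auto

lemma mat_poly_1 [simp]: "mat_poly n A 1 = 1\<^sub>m n"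
  by (simp add: mat_poly_pCons one_pCons one_smult_mat right_mult_zero_mat[OF A])

lemma mat_poly_add: "mat_poly n A (p + q) = mat_poly n A p + mat_poly n A q"
proof (induction p q rule: poly_induct2)
  case (pCons a p b q)
  then show ?case
    by (simp add: mat_poly_pCons mult_add_distrib_mat[of _ n n _ n] scalar_plus_add)
qed simp

lemma mat_poly_smult: "mat_poly n A (Polynomial.smult c p) = c \<cdot>\<^sub>m mat_poly n A p"
  by (induction p) (simp_all add: mat_poly_pCons mult_smult_distrib[of _ n n _ n] scalar_plus_smult)

lemma mat_poly_mult: "mat_poly n A (p * q) = mat_poly n A p * mat_poly n A q"
proof (induction p)
  case (pCons c p)
  have "mat_poly n A (pCons c p * q) = c \<cdot>\<^sub>m mat_poly n A q + A * (mat_poly n A p * mat_poly n A q)"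
    by (simp add: mat_poly_add mat_poly_smult mat_poly_pCons pCons.IH zero_scalar_plus mult_carrier_mat[of _ n n _ n])
  also have "\<dots> = mat_poly n A (pCons c p) * mat_poly n A q"
    by (simp add: mat_poly_pCons left_mult_one_mat[of _ n n] add_mult_distrib_mat[of _ n n _ _ n] assoc_mult_mat[of _ n n _ n _ n]
        mult_smult_assoc_mat[of _ n n _ n])
  finally show ?case .
qed (simp add: left_mult_zero_mat[of _ n n])

lemma mat_poly_X [simp]: "mat_poly n A [:0, 1:] = A"
  by (simp add: mat_poly_pCons zero_scalar_plus[OF A] one_smult_mat right_mult_zero_mat[OF A] right_mult_one_mat[OF A])

lemma mat_poly_diff: "mat_poly n A (p - q) = mat_poly n A p - mat_poly n A q"
  using mat_poly_add[of p "- q"] mat_poly_smult[of "- 1" q] by (simp add: add_uminus_smult[of _ n n])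

lemma mat_poly_commute:
  assumes B: "B \<in> carrier_mat n n" and "A * B = B * A"
  shows "mat_poly n A p * B = B * mat_poly n A p"
proof (induction p)
  case (pCons c p)
  note assoc = assoc_mult_mat[of _ n n _ n _ n] mult_carrier_mat[of _ n n _ n]
  have "mat_poly n A (pCons c p) * B = c \<cdot>\<^sub>m B + A * (mat_poly n A p * B)"
    using B by (simp add: mat_poly_pCons add_mult_distrib_mat[of _ n n _ _ n] assoc mult_smult_assoc_mat[of _ n n _ n])
  also have "A * (mat_poly n A p * B) = (A * B) * mat_poly n A p"
    using B by (simp add: pCons.IH assoc)
  also have "\<dots> = B * (A * mat_poly n A p)"
    unfolding assms(2) using B by (simp add: assoc)
  also have "c \<cdot>\<^sub>m B + \<dots> = B * mat_poly n A (pCons c p)"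
    using B by (simp add: mat_poly_pCons mult_add_distrib_mat[of _ n n _ n] mult_smult_distrib[of _ n n _ n])
  finally show ?case .
qed (use B in simp)

text \<open>\<open>mat_poly_commute\<close> is applied twice: by normality the adjoint of A commutes
  with p(A); taking adjoints, A commutes with the adjoint of p(A), and hence p(A) does.\<close>

lemma normal_mat_poly:
  assumes "normal_mat A"
  shows "normal_mat (mat_poly n A p)"
proof -
  let ?P = "mat_poly n A p"
  have c: "mat_adjoint A \<in> carrier_mat n n" "mat_adjoint ?P \<in> carrier_mat n n" by simp_all
  have "?P * mat_adjoint A = mat_adjoint A * ?P"
    using assms by (intro mat_poly_commute) (auto simp: normal_mat_def)
  then have "mat_adjoint (?P * mat_adjoint A) = mat_adjoint (mat_adjoint A * ?P)" by simp
  then have "A * mat_adjoint ?P = mat_adjoint ?P * A"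
    using c by (simp add: mat_adjoint_mult[of _ n n _ n])
  then show ?thesis
    unfolding normal_mat_def by (intro mat_poly_commute) auto
qed

text \<open>A nilpotent normal matrix is zero: \<open>normal_mat_cancel\<close> removes one factor
  at a time from a vanishing power.\<close>

lemma mat_poly_power_eq_0:
  assumes "normal_mat A" "mat_poly n A (p ^ Suc k) = 0\<^sub>m n n"
  shows "mat_poly n A p = 0\<^sub>m n n"
  using assms(2)
proof (induction k)
  case (Suc k)
  then have "mat_poly n A p * (mat_poly n A p * mat_poly n A (p ^ k)) = 0\<^sub>m n n"
    by (simp add: mat_poly_mult)
  then have "mat_poly n A p * mat_poly n A (p ^ k) = 0\<^sub>m n n"
    by (intro normal_mat_cancel[OF mat_poly_carrier mat_poly_carrier] normal_mat_poly assms)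
  then show ?case by (intro Suc.IH) (simp add: mat_poly_mult)
qed simp

end

section \<open>Annihilating polynomials by triangularisation\<close>

lemma mat_poly_similar:
  assumes sim: "similar_mat_wit A B P Q" and A: "A \<in> carrier_mat n n"
  shows "mat_poly n A p = P * mat_poly n B p * Q"
proof -
  note W = similar_mat_witD2[OF A sim]
  note assoc = assoc_mult_mat[of _ n n _ n _ n] mult_carrier_mat[of _ n n _ n]
  show ?thesis
  proof (induction p)
    case 0
    show ?case using W by simp
  next
    case (pCons c p)
    note B = W(5) and P = W(6) and Q = W(7)
    let ?X = "mat_poly n B p"
    have X: "?X \<in> carrier_mat n n" using B by simp
    have "A * mat_poly n A p = (P * B * Q) * (P * ?X * Q)"
      unfolding pCons.IH using W(3) by simp
    also have "\<dots> = P * (B * ((Q * P) * (?X * Q)))"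
      using B P Q X by (simp add: assoc)
    also have "\<dots> = P * (B * ?X * Q)"
      unfolding W(2) using B P Q X by (simp add: assoc left_mult_one_mat[of _ n n])
    finally have "mat_poly n A (pCons c p) = c \<cdot>\<^sub>m (P * Q) + P * (B * ?X * Q)"
      using A W(1) by (simp add: mat_poly_pCons)
    also have "\<dots> = P * (c \<cdot>\<^sub>m 1\<^sub>m n + B * ?X) * Q"
      using B P Q X
      by (simp add: assoc mult_add_distrib_mat[of _ n n _ n] add_mult_distrib_mat[of _ n n _ _ n]
         mult_smult_distrib[of _ n n _ n] mult_smult_assoc_mat[of _ n n _ n])
    finally show ?case using B by (simp add: mat_poly_pCons)
  qed
qed

text \<open>Cayley-Hamilton for triangular matrices, one row at a time from the bottom. In a row r
  >= k, the factor with the k-th diagonal entry subtracted has nonzero entries only in columns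
  beyond k, and there the remaining product already has zero rows.\<close>

lemma mat_poly_upper_triangular_rows_0:
  assumes B: "B \<in> carrier_mat n n" and ut: "upper_triangular B"
    and "k \<le> n" "k \<le> r" "r < n" "j < n"
  shows "mat_poly n B (\<Prod>i\<leftarrow>[k..<n]. [:- B $$ (i, i), 1:]) $$ (r, j) = 0"
  using assms(3-)
proof (induction k arbitrary: r j rule: inc_induct)
  case (step k)
  let ?q = "\<Prod>i\<leftarrow>[Suc k..<n]. [:- B $$ (i, i), 1:]"
  let ?F = "mat_poly n B [:- B $$ (k, k), 1:]"
  have F: "?F $$ (r, l) = B $$ (r, l) - (if r = l then B $$ (k, k) else 0)" if "l < n" for l
    using B that step.prems right_mult_zero_mat[OF B, of n] right_mult_one_mat[OF B]
    by (simp add: mat_poly_pCons one_smult_mat)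
  have c: "?F \<in> carrier_mat n n" "mat_poly n B ?q \<in> carrier_mat n n" using B by simp_all
  have "mat_poly n B (\<Prod>i\<leftarrow>[k..<n]. [:- B $$ (i, i), 1:]) = ?F * mat_poly n B ?q"
    using step.hyps by (simp only: upt_conv_Cons list.map prod_list.Cons mat_poly_mult[OF B])
  also have "\<dots> $$ (r, j) = (\<Sum>l<n. ?F $$ (r, l) * mat_poly n B ?q $$ (l, j))"
    using step.prems c by (simp add: scalar_prod_def lessThan_atLeast0)
  also have "\<dots> = 0"
  proof (intro sum.neutral ballI)
    fix l assume "l \<in> {..<n}"
    then show "?F $$ (r, l) * mat_poly n B ?q $$ (l, j) = 0"
      using step.IH[of l j] step.prems F[of l] upper_triangularD[OF ut, of l r] B
      by (cases "Suc k \<le> l"; cases "l < r"; cases "l = r") (auto dest: le_antisym[of k r] simp: not_less_eq_eq)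
  qed
  finally show ?case .
qed simp

text \<open>The factorised characteristic polynomial is the input of the Schur decomposition. The
  roots finally taken are the diagonal entries of the triangular form.\<close>

lemma ex_annihilating_poly:
  assumes A: "A \<in> carrier_mat n n"
  shows "\<exists>es. mat_poly n A (\<Prod>e\<leftarrow>es. [:- e, 1:]) = 0\<^sub>m n n"
proof -
  obtain es where es: "char_poly A = (\<Prod>e\<leftarrow>es. [:- e, 1:])"
    using char_poly_factorized[OF A] by blast
  obtain B P Q where "schur_decomposition A es = (B, P, Q)"
    by (metis prod_cases3)
  from schur_decomposition[OF A es this]
  have sim: "similar_mat_wit A B P Q" and ut: "upper_triangular B" by auto
  note W = similar_mat_witD2[OF A sim]
  let ?p = "\<Prod>i\<leftarrow>[0..<n]. [:- B $$ (i, i), 1:]"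
  have "mat_poly n B ?p = 0\<^sub>m n n"
    by (rule eq_matI)
      (use mat_poly_upper_triangular_rows_0[OF W(5) ut, of 0] carrier_matD[OF mat_poly_carrier[OF W(5)]] in auto)
  then have "mat_poly n A ?p = 0\<^sub>m n n"
    using W(6,7) by (simp add: mat_poly_similar[OF sim A])
  then show ?thesis
    by (intro exI[of _ "map (\<lambda>i. B $$ (i, i)) [0..<n]"]) (simp add: o_def)
qed

lemma prod_linear_factors_dvd_power:
  fixes p :: "complex poly"
  assumes "\<And>e. e \<in> set es \<Longrightarrow> poly p e = 0"
  shows "(\<Prod>e\<leftarrow>es. [:- e, 1:]) dvd p ^ length es"
  using assms by (induction es) (auto intro!: mult_dvd_mono simp: poly_eq_0_iff_dvd simp del: mult_pCons_left)

text \<open>This takes the place of diagonalisation: p(A) is determined by the values of p on a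
  finite set. If p vanishes at all roots of an annihilating polynomial, that polynomial divides a
  power of p, so p(A) is nilpotent, and being normal it is zero.\<close>

lemma normal_mat_poly_eq_0:
  assumes A: "A \<in> carrier_mat n n" and nor: "normal_mat A"
  obtains \<Lambda> where "finite \<Lambda>"
    "\<And>p. (\<And>x. x \<in> \<Lambda> \<Longrightarrow> poly p x = 0) \<Longrightarrow> mat_poly n A p = 0\<^sub>m n n"
proof -
  obtain es where es: "mat_poly n A (\<Prod>e\<leftarrow>es. [:- e, 1:]) = 0\<^sub>m n n"
    using ex_annihilating_poly[OF A] by blast
  have "mat_poly n A p = 0\<^sub>m n n" if "\<And>x. x \<in> set es \<Longrightarrow> poly p x = 0" for p
  proof -
    have "(\<Prod>e\<leftarrow>es. [:- e, 1:]) dvd p ^ length es"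
      using that by (rule prod_linear_factors_dvd_power)
    then obtain q where q: "p ^ length es = (\<Prod>e\<leftarrow>es. [:- e, 1:]) * q" ..
    \<comment> \<open>The exponent is raised by one because \<open>mat_poly_power_eq_0\<close> asks
      for a positive one, also when \<open>es\<close> is empty.\<close>
    have "mat_poly n A (p ^ Suc (length es)) = mat_poly n A p * (0\<^sub>m n n * mat_poly n A q)"
      by (simp only: power_Suc q mat_poly_mult[OF A] es)
    also have "\<dots> = 0\<^sub>m n n"
      using mat_poly_carrier[OF A, of p] mat_poly_carrier[OF A, of q] by simp
    finally have "mat_poly n A (p ^ Suc (length es)) = 0\<^sub>m n n" .
    then show ?thesis by (rule mat_poly_power_eq_0[OF A nor])
  qed
  then show ?thesis by (intro that[of "set es"]) auto
qed

section \<open>Interpolation, pseudo-inverses and matrices with equal Gram matrices\<close>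

lemma ex_interpolating_poly:
  fixes f :: "complex \<Rightarrow> complex"
  assumes "finite \<Lambda>"
  shows "\<exists>p. \<forall>x\<in>\<Lambda>. poly p x = f x"
  using assms
proof (induction \<Lambda> rule: finite_induct)
  case (insert a \<Lambda>)
  obtain p where p: "\<forall>x\<in>\<Lambda>. poly p x = f x" using insert.IH ..
  define q where "q = (\<Prod>x\<in>\<Lambda>. [:- x, 1:])"
  have poly_q: "poly q y = (\<Prod>x\<in>\<Lambda>. y - x)" for y
    by (simp add: q_def poly_prod)
  have q0: "poly q x = 0" if "x \<in> \<Lambda>" for x
    using insert.hyps(1) that by (auto simp: poly_q)
  show ?case
  \<comment> \<open>Newton's step: \<open>q\<close> vanishes on the old nodes, so a multiple of it
    corrects the value at \<open>a\<close> without disturbing the others.\<close>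
  proof (intro exI[of _ "p + Polynomial.smult ((f a - poly p a) / poly q a) q"] ballI)
    fix x assume "x \<in> insert a \<Lambda>"
    then consider "x = a" | "x \<in> \<Lambda>" by blast
    then show "poly (p + Polynomial.smult ((f a - poly p a) / poly q a) q) x = f x"
    proof cases
      case 1
      have "poly q a \<noteq> 0" using insert.hyps by (auto simp: poly_q)
      with 1 show ?thesis by (simp only: poly_add poly_smult) simp
    next
      case 2
      then show ?thesis using p by (simp add: q0)
    qed
  qed
qed simp

text \<open>\<open>g\<close> interpolates 1/x on the finite set that decides about polynomials of
  \<open>R\<close>. There x = g(x) x^2, at x = 0 because both sides vanish. Thus g(R) inverts
  \<open>R\<close> on the range of \<open>R\<close>.\<close>

lemma hermitian_pseudo_inverse:
  assumes R: "R \<in> carrier_mat n n" and herm: "mat_adjoint R = R"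
  obtains g where "R = mat_poly n R g * R * R"
proof -
  have "normal_mat R" using herm by (simp add: normal_mat_def)
  then obtain \<Lambda> where "finite \<Lambda>"
    and \<Lambda>: "\<And>p. (\<And>x. x \<in> \<Lambda> \<Longrightarrow> poly p x = 0) \<Longrightarrow> mat_poly n R p = 0\<^sub>m n n"
    using normal_mat_poly_eq_0[OF R] by blast
  then obtain g where g: "\<And>x. x \<in> \<Lambda> \<Longrightarrow> poly g x = inverse x"
    using ex_interpolating_poly[of \<Lambda> inverse] by blast
  have "mat_poly n R ([:0, 1:] - g * [:0, 1:] * [:0, 1:]) = 0\<^sub>m n n"
  proof (rule \<Lambda>)
    fix x assume "x \<in> \<Lambda>"
    then show "poly ([:0, 1:] - g * [:0, 1:] * [:0, 1:]) x = 0"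
      by (cases "x = 0") (simp_all add: g)
  qed
  then have "R - mat_poly n R g * R * R = 0\<^sub>m n n"
    by (simp only: mat_poly_diff[OF R] mat_poly_mult[OF R] mat_poly_X[OF R])
  then have "R = mat_poly n R g * R * R"
    by (rule minus_mat_eq_0D[of _ n n, rotated 2]) (use R in \<open>simp_all add: mult_carrier_mat[of _ n n _ n]\<close>)
  then show ?thesis by (rule that)
qed

text \<open>The operator is \<open>G N M\<^sup>*\<close> where \<open>G\<close> is the pseudo-inverse of \<open>M M\<^sup>*\<close>.\<close>

lemma ex_normal_mat_mult_eq:
  assumes M: "M \<in> carrier_mat n r" and N: "N \<in> carrier_mat n r"
    and row: "mat_adjoint M * M = mat_adjoint N * N"
    and col: "M * mat_adjoint M = N * mat_adjoint N"
  obtains W where "W \<in> carrier_mat n n" "normal_mat W" "W * M = N"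
proof -
  define R where "R = M * mat_adjoint M"
  define A where "A = N * mat_adjoint M"
  have c: "mat_adjoint M \<in> carrier_mat r n" "mat_adjoint N \<in> carrier_mat r n"
    using M N by simp_all
  note cs = c M N
  have R: "R \<in> carrier_mat n n" and A: "A \<in> carrier_mat n n"
    unfolding R_def A_def using cs by auto
  have herm: "mat_adjoint R = R"
    unfolding R_def using cs by (simp add: mat_adjoint_mult[of _ n r _ n])
  have adA: "mat_adjoint A = M * mat_adjoint N"
    unfolding A_def using cs by (simp add: mat_adjoint_mult[of _ n r _ n])
  note asr = assoc_mult_mat[of _ n r _ n _ n] assoc_mult_mat[of _ n r _ n _ r]
    assoc_mult_mat[of _ r n _ r _ n] assoc_mult_mat[of _ r n _ r _ r]
    mult_carrier_mat[of _ n r _ n] mult_carrier_mat[of _ n n _ n] mult_carrier_mat[of _ r n _ r]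
    mult_carrier_mat[of _ n n _ r] mult_carrier_mat[of _ r n _ n]
    mult_carrier_mat[of _ r r _ n] mult_carrier_mat[of _ n r _ r]
  note assoc = assoc_mult_mat[of _ n n _ n _ n] assoc_mult_mat[of _ n n _ n _ r] mult_carrier_mat[of _ n n _ n] mult_carrier_mat[of _ n n _ r]
  \<comment> \<open>\<open>row\<close> allows M^* M to be traded for N^* N inside a product.
    Together with \<open>col\<close> this gives A A^* = A^* A = R^2 and makes A commute with
    R.\<close>
  have sandwich: "X * mat_adjoint M * (M * Y) = X * mat_adjoint N * (N * Y)"
    if "X \<in> carrier_mat n r" "Y \<in> carrier_mat r n" for X Y
  proof -
    have "X * mat_adjoint M * (M * Y) = X * (mat_adjoint M * M * Y)"
      using that cs by (simp add: asr)
    also have "\<dots> = X * mat_adjoint N * (N * Y)"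
      unfolding row using that cs by (simp add: asr)
    finally show ?thesis .
  qed
  have AA: "A * mat_adjoint A = R * R"
    unfolding adA unfolding A_def using sandwich[OF N c(2)] by (simp add: R_def col)
  have AA': "mat_adjoint A * A = R * R"
    unfolding adA unfolding A_def using sandwich[OF M c(1)] by (simp add: R_def)
  have AR: "A * R = R * A"
  proof -
    have "A * R = N * mat_adjoint N * (N * mat_adjoint M)"
      unfolding A_def R_def by (rule sandwich[OF N c(1)])
    then show ?thesis by (simp add: R_def A_def col)
  qed
  have AR': "mat_adjoint A * R = R * mat_adjoint A"
    using arg_cong[OF AR, of mat_adjoint] A R by (simp add: mat_adjoint_mult[of _ n n _ n] herm)
  obtain g where g: "R = mat_poly n R g * R * R"
    using hermitian_pseudo_inverse[OF R herm] .
  define G where "G = mat_poly n R g"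
  have G: "G \<in> carrier_mat n n" using R by (simp add: G_def)
  have "G * (R * R) = G * R * R" using G R by (simp add: assoc)
  also have "\<dots> = R" unfolding G_def by (rule g[symmetric])
  finally have GRR: "G * (R * R) = R" .
  \<comment> \<open>As a polynomial in R, the matrix G commutes with everything that commutes with
    R, in particular with A and its adjoint.\<close>
  have GA: "G * A = A * G" and GA': "G * mat_adjoint A = mat_adjoint A * G"
    unfolding G_def using A AR AR' by (auto intro!: mat_poly_commute[OF R])
  have G'A: "mat_adjoint G * A = A * mat_adjoint G"
    using arg_cong[OF GA', of mat_adjoint] A G by (simp add: mat_adjoint_mult[of _ n n _ n])
  have GG: "G * mat_adjoint G = mat_adjoint G * G"
    using normal_mat_poly[OF R, of g] herm by (simp add: G_def normal_mat_def)
  define W where "W = G * A"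
  have W: "W \<in> carrier_mat n n" using G A by (simp add: W_def assoc)
  have adW: "mat_adjoint W = mat_adjoint A * mat_adjoint G"
    using G A by (simp add: W_def mat_adjoint_mult[of _ n n _ n])
  \<comment> \<open>The commutation relations move G and its adjoint past A and its adjoint, and A
    A^* = A^* A does the rest.\<close>
  have "W * mat_adjoint W = G * ((A * mat_adjoint A) * mat_adjoint G)"
    unfolding adW using G A by (simp add: W_def assoc)
  also have "\<dots> = G * (mat_adjoint A * (A * mat_adjoint G))"
    unfolding AA AA'[symmetric] using G A by (simp add: assoc)
  also have "\<dots> = (G * mat_adjoint A) * (mat_adjoint G * A)"
    using G A by (simp add: assoc G'A)
  also have "\<dots> = mat_adjoint A * ((G * mat_adjoint G) * A)"
    unfolding GA' using G A by (simp add: assoc)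
  also have "\<dots> = mat_adjoint W * W"
    unfolding GG adW using G A by (simp add: assoc W_def)
  finally have nor: "normal_mat W" by (simp add: normal_mat_def)
  \<comment> \<open>Z kills the range of R = N N^*, so Z N N^* Z^* = 0 and therefore Z N = 0. This
    says N = G R N: the columns of N lie where G inverts R.\<close>
  define Z where "Z = 1\<^sub>m n - G * R"
  have Z: "Z \<in> carrier_mat n n" using G R by (simp add: Z_def assoc minus_carrier_mat)
  have ZR: "Z * R = 0\<^sub>m n n"
    unfolding Z_def using G R GRR by (simp add: assoc minus_mult_distrib_mat[of _ n n _ _ n])
  have "Z * N * mat_adjoint (Z * N) = Z * (N * mat_adjoint N) * mat_adjoint Z"
    using Z cs by (simp add: mat_adjoint_mult[of _ n n _ r] asr assoc assoc_mult_mat[of _ n n _ r _ n])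
  also have "\<dots> = 0\<^sub>m n n" using ZR Z by (simp add: R_def col)
  finally have "mat_adjoint (Z * N) = 0\<^sub>m r n"
    using mat_adjoint_mult_self_eq_0[of "mat_adjoint (Z * N)" r n] Z N
    by (simp add: assoc)
  then have "Z * N = 0\<^sub>m n r"
    by (metis mat_adjoint_adjoint mat_adjoint_zero)
  then have "N - G * (R * N) = 0\<^sub>m n r"
    unfolding Z_def using G R N by (simp add: assoc minus_mult_distrib_mat[of _ n n _ _ r])
  then have NG: "N = G * (R * N)"
    by (rule minus_mat_eq_0D[rotated 2]) (use G R N in \<open>simp_all add: assoc\<close>)
  have "W * M = G * (R * N)"
  proof -
    \<comment> \<open>By \<open>row\<close>, the product N M^* M equals N N^* N, which is R N by
      \<open>col\<close>.\<close>
    have "W * M = G * (N * (mat_adjoint M * M))"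
      unfolding W_def A_def using G cs by (simp add: asr assoc)
    also have "\<dots> = G * (R * N)"
      unfolding row R_def col using G cs by (simp add: asr)
    finally show ?thesis .
  qed
  also note NG[symmetric]
  finally show ?thesis by (rule that[OF W nor])
qed

section \<open>Local operators on the tensor product\<close>

lemma finite_multi_indices [simp]: "finite I \<Longrightarrow> finite (multi_indices I d)"
  by (simp add: multi_indices_def finite_PiE)

lemma multi_indices_upd:
  assumes "i \<in> I" "k \<in> multi_indices (I - {i}) d" "a < d i"
  shows "k(i := a) \<in> multi_indices I d"
  using assms by (auto simp: multi_indices_def PiE_def Pi_def extensional_def)

text \<open>Multi-indices are extensional functions, so deleting the coordinate i means resetting it
  to \<open>undefined\<close>.\<close>

lemma multi_indices_remove:
  assumes "i \<in> I" "k \<in> multi_indices I d"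
  shows "k(i := undefined) \<in> multi_indices (I - {i}) d" "k i < d i"
  using assms by (auto simp: multi_indices_def PiE_def Pi_def extensional_def)

lemma multi_indices_eqI:
  assumes "k \<in> multi_indices I d" "l \<in> multi_indices I d" "\<And>i. i \<in> I \<Longrightarrow> k i = l i"
  shows "k = l"
  using assms unfolding multi_indices_def by (rule PiE_ext)

lemma sum_multi_indices_remove:
  assumes "i \<in> I"
  shows "(\<Sum>k\<in>multi_indices I d. f k) = (\<Sum>k\<in>multi_indices (I - {i}) d. \<Sum>a<d i. f (k(i := a)))"
proof -
  have undef: "k i = undefined" if "k \<in> multi_indices (I - {i}) d" for k
    using that by (auto simp: multi_indices_def PiE_def extensional_def)
  have "(\<Sum>k\<in>multi_indices I d. f k)
      = (\<Sum>(k, a)\<in>multi_indices (I - {i}) d \<times> {..<d i}. f (k(i := a)))"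
    by (rule sum.reindex_bij_witness[of _ "\<lambda>(k, a). k(i := a)" "\<lambda>k. (k(i := undefined), k i)"])
      (use assms in \<open>auto simp: multi_indices_upd multi_indices_remove undef fun_upd_idem\<close>)
  then show ?thesis by (simp add: sum.cartesian_product)
qed

section \<open>Action of product operators and one-particle operators on vectors\<close>

abbreviation tensor_apply ::
  "nat set \<Rightarrow> (nat \<Rightarrow> nat) \<Rightarrow> (nat \<Rightarrow> complex mat) \<Rightarrow> tvec \<Rightarrow> tvec" where
  "tensor_apply I d A \<psi> \<equiv> op_apply I d (tensor_op I d A) \<psi>"

abbreviation local_apply ::
  "nat set \<Rightarrow> (nat \<Rightarrow> nat) \<Rightarrow> nat \<Rightarrow> complex mat \<Rightarrow> tvec \<Rightarrow> tvec" where
  "local_apply I d i A \<psi> \<equiv> op_apply I d (local_op I d i A) \<psi>"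

lemma tensor_apply_cong:
  assumes "\<And>i. i \<in> I \<Longrightarrow> A i = B i"
  shows "tensor_apply I d A \<psi> = tensor_apply I d B \<psi>"
proof -
  have "tensor_op I d A = tensor_op I d B"
    using assms by (auto simp: tensor_op_def fun_eq_iff intro!: prod.cong)
  then show ?thesis by simp
qed

lemma tensor_apply_in_tensor_space: "tensor_apply I d A \<psi> \<in> tensor_space I d"
  by (auto simp: tensor_space_def op_apply_def tensor_op_def)

lemma local_apply_in_tensor_space: "local_apply I d i A \<psi> \<in> tensor_space I d"
  by (simp add: local_op_def tensor_apply_in_tensor_space)

lemma tensor_space_eqI:
  assumes "\<phi> \<in> tensor_space I d" "\<psi> \<in> tensor_space I d" "\<And>k. k \<in> multi_indices I d \<Longrightarrow> \<phi> k = \<psi> k"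
  shows "\<phi> = \<psi>"
  using assms by (auto simp: tensor_space_def fun_eq_iff) metis

lemma tensor_apply_in:
  "k \<in> multi_indices I d \<Longrightarrow>
    tensor_apply I d A \<psi> k = (\<Sum>l\<in>multi_indices I d. (\<Prod>i\<in>I. A i $$ (k i, l i)) * \<psi> l)"
  by (simp add: op_apply_def tensor_op_def)

lemma op_apply_sum: "op_apply I d R (\<lambda>k. \<Sum>j\<in>J. \<psi> j k) = (\<lambda>k. \<Sum>j\<in>J. op_apply I d R (\<psi> j) k)"
  unfolding op_apply_def sum_distrib_left by (rule ext, rule sum.swap)

lemma op_apply_zero: "op_apply I d R (\<lambda>k. 0) = (\<lambda>k. 0)"
  by (simp add: op_apply_def)

lemma prod_delta:
  assumes "finite I"
  shows "(\<Prod>i\<in>I. if k i = l i then 1 else 0 :: complex) = (if \<forall>i\<in>I. k i = l i then 1 else 0)"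
  using assms by (induction I rule: finite_induct) auto

context
  fixes I :: "nat set"
  assumes fin [simp]: "finite I"
begin

text \<open>The intermediate multi-index ranges over a product set, so the sum over it factorises
  into one sum per particle, and these are the entries of \<open>A i * B i\<close>.\<close>

lemma tensor_apply_mult:
  assumes A: "\<And>i. i \<in> I \<Longrightarrow> A i \<in> carrier_mat (d i) (d i)"
    and B: "\<And>i. i \<in> I \<Longrightarrow> B i \<in> carrier_mat (d i) (d i)"
  shows "tensor_apply I d A (tensor_apply I d B \<psi>) = tensor_apply I d (\<lambda>i. A i * B i) \<psi>"
proof (rule tensor_space_eqI[OF tensor_apply_in_tensor_space tensor_apply_in_tensor_space])
  fix k assume k: "k \<in> multi_indices I d"
  let ?M = "multi_indices I d"
  have *: "(\<Sum>l\<in>?M. (\<Prod>i\<in>I. A i $$ (k i, l i)) * (\<Prod>i\<in>I. B i $$ (l i, m i)))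
      = (\<Prod>i\<in>I. (A i * B i) $$ (k i, m i))" if m: "m \<in> ?M" for m
  proof -
    have "(\<Prod>i\<in>I. (A i * B i) $$ (k i, m i)) = (\<Prod>i\<in>I. \<Sum>a<d i. A i $$ (k i, a) * B i $$ (a, m i))"
    proof (rule prod.cong[OF refl])
      fix i assume i: "i \<in> I"
      then have "k i < d i" "m i < d i" using k m by (auto simp: multi_indices_def)
      then show "(A i * B i) $$ (k i, m i) = (\<Sum>a<d i. A i $$ (k i, a) * B i $$ (a, m i))"
        using A[OF i] B[OF i] by (simp add: scalar_prod_def lessThan_atLeast0)
    qed
    also have "\<dots> = (\<Sum>l\<in>?M. \<Prod>i\<in>I. A i $$ (k i, l i) * B i $$ (l i, m i))"
      unfolding multi_indices_def by (rule prod_sum_PiE) auto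
    finally show ?thesis by (simp add: prod.distrib)
  qed
  have "tensor_apply I d A (tensor_apply I d B \<psi>) k
      = (\<Sum>l\<in>?M. \<Sum>m\<in>?M. (\<Prod>i\<in>I. A i $$ (k i, l i)) * ((\<Prod>i\<in>I. B i $$ (l i, m i)) * \<psi> m))"
    using k by (simp add: tensor_apply_in sum_distrib_left)
  also have "\<dots> = (\<Sum>m\<in>?M. (\<Sum>l\<in>?M. (\<Prod>i\<in>I. A i $$ (k i, l i)) * (\<Prod>i\<in>I. B i $$ (l i, m i))) * \<psi> m)"
    by (subst sum.swap) (simp add: sum_distrib_right mult.assoc)
  also have "\<dots> = tensor_apply I d (\<lambda>i. A i * B i) \<psi> k"
    using k by (simp add: tensor_apply_in *)
  finally show "tensor_apply I d A (tensor_apply I d B \<psi>) k = tensor_apply I d (\<lambda>i. A i * B i) \<psi> k" .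
qed

text \<open>The identity factors force the column index to agree with k outside i, so the sum over
  multi-indices collapses to a sum over the coordinate i.\<close>

lemma local_apply_in:
  assumes i: "i \<in> I" and k: "k \<in> multi_indices I d"
  shows "local_apply I d i A \<psi> k = (\<Sum>a<d i. A $$ (k i, a) * \<psi> (k(i := a)))"
proof -
  let ?k = "k(i := undefined)"
  have *: "(\<Prod>m\<in>I. (if m = i then A else 1\<^sub>m (d m)) $$ (k m, (l(i := a)) m))
      = A $$ (k i, a) * (if l = ?k then 1 else 0)"
    if l: "l \<in> multi_indices (I - {i}) d" and a: "a < d i" for l a
  proof -
    have "(\<Prod>m\<in>I. (if m = i then A else 1\<^sub>m (d m)) $$ (k m, (l(i := a)) m))
        = A $$ (k i, a) * (\<Prod>m\<in>I - {i}. 1\<^sub>m (d m) $$ (k m, l m))"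
      using i by (simp add: prod.remove[of I i])
    also have "(\<Prod>m\<in>I - {i}. 1\<^sub>m (d m) $$ (k m, l m)) = (\<Prod>m\<in>I - {i}. if k m = l m then 1 else 0 :: complex)"
    proof (rule prod.cong[OF refl])
      fix m assume "m \<in> I - {i}"
      then have "k m < d m" "l m < d m" using multi_indices_remove(2)[OF _ k] multi_indices_remove(2)[OF _ l] by auto
      then show "1\<^sub>m (d m) $$ (k m, l m) = (if k m = l m then 1 else 0 :: complex)" by simp
    qed
    also have "\<dots> = (if l = ?k then 1 else 0)"
    proof -
      have "(\<forall>m\<in>I - {i}. k m = l m) \<longleftrightarrow> l = ?k"
      proof
        assume "\<forall>m\<in>I - {i}. k m = l m"
        then show "l = ?k"
          by (intro multi_indices_eqI[OF l multi_indices_remove(1)[OF i k]]) auto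
      qed auto
      then show ?thesis by (simp add: prod_delta)
    qed
    finally show ?thesis .
  qed
  have "local_apply I d i A \<psi> k = (\<Sum>l\<in>multi_indices (I - {i}) d. \<Sum>a<d i.
      (if l = ?k then A $$ (k i, a) * \<psi> (l(i := a)) else 0))"
    unfolding local_op_def tensor_apply_in[OF k] sum_multi_indices_remove[OF i]
    by (intro sum.cong refl, subst *) simp_all
  also have "\<dots> = (\<Sum>l\<in>multi_indices (I - {i}) d.
      if l = ?k then \<Sum>a<d i. A $$ (k i, a) * \<psi> (l(i := a)) else 0)"
    by (intro sum.cong) auto
  also have "\<dots> = (\<Sum>a<d i. A $$ (k i, a) * \<psi> (?k(i := a)))"
    using multi_indices_remove(1)[OF i k] by (simp add: sum.delta)
  finally show ?thesis by simp
qed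

lemma local_apply_one:
  assumes "\<psi> \<in> tensor_space I d"
  shows "i \<in> I \<Longrightarrow> local_apply I d i (1\<^sub>m (d i)) \<psi> = \<psi>"
proof (rule tensor_space_eqI[OF local_apply_in_tensor_space assms])
  fix k assume i: "i \<in> I" and k: "k \<in> multi_indices I d"
  have "(\<Sum>a<d i. 1\<^sub>m (d i) $$ (k i, a) * \<psi> (k(i := a))) = (\<Sum>a<d i. if a = k i then \<psi> k else 0)"
    using multi_indices_remove(2)[OF i k] by (intro sum.cong) auto
  then show "local_apply I d i (1\<^sub>m (d i)) \<psi> k = \<psi> k"
    using i k multi_indices_remove(2)[OF i k] by (simp add: local_apply_in)
qed

lemma local_apply_zero:
  assumes "i \<in> I"
  shows "local_apply I d i (0\<^sub>m (d i) (d i)) \<psi> = (\<lambda>k. 0)"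
  by (rule tensor_space_eqI[OF local_apply_in_tensor_space])
    (use assms in \<open>auto simp: tensor_space_def local_apply_in multi_indices_remove\<close>)

text \<open>The shape is that of one Horner step of \<open>mat_poly\<close>, for the induction over
  polynomials below.\<close>

lemma local_apply_scalar_plus:
  assumes "i \<in> I" "A \<in> carrier_mat (d i) (d i)" and \<psi>: "\<psi> \<in> tensor_space I d"
  shows "local_apply I d i (c \<cdot>\<^sub>m 1\<^sub>m (d i) + A) \<psi> = (\<lambda>k. c * \<psi> k + local_apply I d i A \<psi> k)"
proof (rule tensor_space_eqI[OF local_apply_in_tensor_space])
  show "(\<lambda>k. c * \<psi> k + local_apply I d i A \<psi> k) \<in> tensor_space I d"
    using \<psi> local_apply_in_tensor_space[of I d i A \<psi>] by (simp add: tensor_space_def)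
  fix k assume k: "k \<in> multi_indices I d"
  have "(\<Sum>a<d i. (c \<cdot>\<^sub>m 1\<^sub>m (d i) + A) $$ (k i, a) * \<psi> (k(i := a)))
      = (\<Sum>a<d i. (if a = k i then c * \<psi> (k(i := a)) else 0) + A $$ (k i, a) * \<psi> (k(i := a)))"
    using multi_indices_remove(2)[OF assms(1) k] assms(2) by (intro sum.cong) (auto simp: algebra_simps)
  also have "\<dots> = c * \<psi> k + (\<Sum>a<d i. A $$ (k i, a) * \<psi> (k(i := a)))"
    using multi_indices_remove(2)[OF assms(1) k] by (simp add: sum.distrib sum.delta)
  finally show "local_apply I d i (c \<cdot>\<^sub>m 1\<^sub>m (d i) + A) \<psi> k = c * \<psi> k + local_apply I d i A \<psi> k"
    using assms k by (simp add: local_apply_in)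
qed

lemma local_apply_mult:
  assumes "i \<in> I" "A \<in> carrier_mat (d i) (d i)" "B \<in> carrier_mat (d i) (d i)"
  shows "local_apply I d i A (local_apply I d i B \<psi>) = local_apply I d i (A * B) \<psi>"
  unfolding local_op_def using assms
  by (subst tensor_apply_mult) (auto intro!: tensor_apply_cong)

text \<open>Both orders give the same product operator, with A at i, B at m and identities
  elsewhere.\<close>

lemma local_apply_commute:
  assumes "i \<noteq> m" "A \<in> carrier_mat (d i) (d i)" "B \<in> carrier_mat (d m) (d m)"
  shows "local_apply I d i A (local_apply I d m B \<psi>) = local_apply I d m B (local_apply I d i A \<psi>)"
  unfolding local_op_def using assms
  by (subst (1 2) tensor_apply_mult) (auto intro!: tensor_apply_cong)

lemma tensor_apply_local_apply:
  assumes "i \<in> I" "\<And>m. m \<in> I \<Longrightarrow> A m \<in> carrier_mat (d m) (d m)" "B \<in> carrier_mat (d i) (d i)"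
  shows "tensor_apply I d A (local_apply I d i B \<psi>) = tensor_apply I d (A(i := A i * B)) \<psi>"
  unfolding local_op_def using assms
  by (subst tensor_apply_mult) (auto simp: right_mult_one_mat[OF assms(2)] intro!: tensor_apply_cong)

lemma local_apply_tensor_apply:
  assumes "i \<in> I" "\<And>m. m \<in> I \<Longrightarrow> A m \<in> carrier_mat (d m) (d m)" "B \<in> carrier_mat (d i) (d i)"
  shows "local_apply I d i B (tensor_apply I d A \<psi>) = tensor_apply I d (A(i := B * A i)) \<psi>"
  unfolding local_op_def using assms
  by (subst tensor_apply_mult) (auto simp: left_mult_one_mat[OF assms(2)] intro!: tensor_apply_cong)

lemma tensor_apply_eq_0:
  assumes "i \<in> I" "A i = 0\<^sub>m (d i) (d i)"
  shows "tensor_apply I d A \<psi> = (\<lambda>k. 0)"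
proof (rule tensor_space_eqI[OF tensor_apply_in_tensor_space])
  fix k assume k: "k \<in> multi_indices I d"
  have "(\<Prod>m\<in>I. A m $$ (k m, l m)) = 0" if "l \<in> multi_indices I d" for l
    using assms multi_indices_remove(2)[OF assms(1) k] multi_indices_remove(2)[OF assms(1) that]
    by (intro prod_zero bexI[of _ i]) auto
  then show "tensor_apply I d A \<psi> k = 0" using k by (simp add: tensor_apply_in)
qed (simp add: tensor_space_def)

text \<open>Conjugating an entry of the local operator gives the transposed entry of the one built
  from the adjoint; it remains to exchange the two sums.\<close>

lemma tinner_local_apply:
  assumes "i \<in> I" "A \<in> carrier_mat (d i) (d i)"
  shows "tinner I d (local_apply I d i A \<phi>) \<psi> = tinner I d \<phi> (local_apply I d i (mat_adjoint A) \<psi>)"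
proof -
  have adj: "cnj (\<Prod>m\<in>I. (if m = i then A else 1\<^sub>m (d m)) $$ (k m, l m))
     = (\<Prod>m\<in>I. (if m = i then mat_adjoint A else 1\<^sub>m (d m)) $$ (l m, k m))"
    if "k \<in> multi_indices I d" "l \<in> multi_indices I d" for k l
    unfolding cnj_prod
  proof (rule prod.cong[OF refl])
    fix m assume "m \<in> I"
    then have "k m < d m" "l m < d m" using multi_indices_remove(2)[OF _ that(1)] multi_indices_remove(2)[OF _ that(2)] by auto
    then show "cnj ((if m = i then A else 1\<^sub>m (d m)) $$ (k m, l m))
        = (if m = i then mat_adjoint A else 1\<^sub>m (d m)) $$ (l m, k m)"
      using assms(2) by (cases "m = i") auto
  qed
  have "tinner I d (local_apply I d i A \<phi>) \<psi> = (\<Sum>k\<in>multi_indices I d. \<Sum>l\<in>multi_indices I d.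
      (\<Prod>m\<in>I. (if m = i then mat_adjoint A else 1\<^sub>m (d m)) $$ (l m, k m)) * cnj (\<phi> l) * \<psi> k)"
    by (simp add: tinner_def local_op_def tensor_apply_in cnj_sum adj sum_distrib_right del: cnj_prod)
  also have "\<dots> = tinner I d \<phi> (local_apply I d i (mat_adjoint A) \<psi>)"
    by (subst sum.swap)
      (simp add: tinner_def local_op_def tensor_apply_in sum_distrib_left ac_simps)
  finally show ?thesis .
qed

end

section \<open>Projectors acting in the same way for all particles\<close>

lemma tinner_self: "tinner I d \<psi> \<psi> = of_real ((tnorm I d \<psi>)\<^sup>2)"
  unfolding tinner_def tnorm_def
  by (subst real_sqrt_pow2) (auto simp: sum_nonneg complex_norm_square mult.commute simp flip: of_real_power)

lemma tinner_diff_left: "tinner I d (\<lambda>k. \<phi> k - \<chi> k) \<psi> = tinner I d \<phi> \<psi> - tinner I d \<chi> \<psi>"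
  by (simp add: tinner_def sum_subtractf algebra_simps)

lemma tinner_cmult_left: "tinner I d (\<lambda>k. c * \<phi> k) \<psi> = cnj c * tinner I d \<phi> \<psi>"
  by (simp add: tinner_def sum_distrib_left mult.assoc)

lemma diff_eq_zero_fun_iff: "(\<lambda>k. \<psi> k - \<chi> k) = (\<lambda>k. 0) \<longleftrightarrow> \<chi> = (\<psi> :: tvec)"
  by (auto simp: fun_eq_iff)

lemma tnorm_eq_0_iff:
  assumes "finite I" "\<psi> \<in> tensor_space I d"
  shows "tnorm I d \<psi> = 0 \<longleftrightarrow> \<psi> = (\<lambda>k. 0)"
proof
  assume "tnorm I d \<psi> = 0"
  then have "\<forall>k\<in>multi_indices I d. (cmod (\<psi> k))\<^sup>2 = 0"
    using assms(1) by (simp add: tnorm_def sum_nonneg_eq_0_iff)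
  then show "\<psi> = (\<lambda>k. 0)"
    using assms(2) by (auto simp: tensor_space_def fun_eq_iff)
qed (simp add: tnorm_def)

lemma tnorm_cmult: "tnorm I d (\<lambda>k. c * \<psi> k) = cmod c * tnorm I d \<psi>"
  by (simp add: tnorm_def norm_mult power_mult_distrib real_sqrt_mult flip: sum_distrib_left)

lemma projectorD:
  assumes "projector n P"
  shows "P \<in> carrier_mat n n" "P * P = P" "mat_adjoint P = P"
  using assms by (auto simp: projector_def)

lemma
  assumes "projector n P"
  shows projector_complement: "projector n (1\<^sub>m n - P)"
    and projector_mult_complement: "P * (1\<^sub>m n - P) = 0\<^sub>m n n"
    and complement_mult_projector: "(1\<^sub>m n - P) * P = 0\<^sub>m n n"
proof -
  note P = projectorD[OF assms]
  show 1: "P * (1\<^sub>m n - P) = 0\<^sub>m n n"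
    using P by (simp add: mult_minus_distrib_mat[of _ n n _ n])
  show "(1\<^sub>m n - P) * P = 0\<^sub>m n n"
    using P by (simp add: minus_mult_distrib_mat[of _ n n _ _ n])
  have c: "1\<^sub>m n - P \<in> carrier_mat n n" by (rule minus_carrier_mat[OF P(1)])
  have "(1\<^sub>m n - P) * (1\<^sub>m n - P) = 1\<^sub>m n * (1\<^sub>m n - P) - P * (1\<^sub>m n - P)"
    by (rule minus_mult_distrib_mat[OF one_carrier_mat P(1) c])
  also have "\<dots> = 1\<^sub>m n - P"
    unfolding 1 left_mult_one_mat[OF c] by (rule eq_matI) (use P in auto)
  finally show "projector n (1\<^sub>m n - P)"
    using c P by (simp add: projector_def mat_adjoint_minus[of _ n n])
qed

definition agreeing_projections ::
  "nat set \<Rightarrow> (nat \<Rightarrow> nat) \<Rightarrow> tvec \<Rightarrow> (nat \<Rightarrow> complex mat) \<Rightarrow> tvec \<Rightarrow> bool" where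
  "agreeing_projections I d \<psi> P \<chi> \<longleftrightarrow>
     (\<forall>i\<in>I. projector (d i) (P i) \<and> local_apply I d i (P i) \<psi> = \<chi>)"

text \<open>The two inequalities say that \<chi> and \<psi> - \<chi> are nonzero, so that both
  outcomes of the measurement by \<open>P i\<close> and its complement occur.\<close>

definition splittable :: "nat set \<Rightarrow> (nat \<Rightarrow> nat) \<Rightarrow> tvec \<Rightarrow> bool" where
  "splittable I d \<psi> \<longleftrightarrow> (\<exists>P \<chi>. agreeing_projections I d \<psi> P \<chi> \<and> \<chi> \<noteq> (\<lambda>k. 0) \<and> \<chi> \<noteq> \<psi>)"

context
  fixes I :: "nat set" and d :: "nat \<Rightarrow> nat"
  assumes fin [simp]: "finite I"
begin

lemma local_apply_add:
  assumes "i \<in> I" "A \<in> carrier_mat (d i) (d i)" "B \<in> carrier_mat (d i) (d i)"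
  shows "local_apply I d i (A + B) \<psi> = (\<lambda>k. local_apply I d i A \<psi> k + local_apply I d i B \<psi> k)"
proof (rule tensor_space_eqI[OF local_apply_in_tensor_space])
  show "(\<lambda>k. local_apply I d i A \<psi> k + local_apply I d i B \<psi> k) \<in> tensor_space I d"
    using local_apply_in_tensor_space[of I d i A \<psi>] local_apply_in_tensor_space[of I d i B \<psi>]
    by (simp add: tensor_space_def)
  fix k assume k: "k \<in> multi_indices I d"
  have "(\<Sum>a<d i. (A + B) $$ (k i, a) * \<psi> (k(i := a)))
      = (\<Sum>a<d i. A $$ (k i, a) * \<psi> (k(i := a)) + B $$ (k i, a) * \<psi> (k(i := a)))"
    using multi_indices_remove(2)[OF assms(1) k] assms(2,3)
    by (intro sum.cong) (auto simp: distrib_right)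
  then show "local_apply I d i (A + B) \<psi> k = local_apply I d i A \<psi> k + local_apply I d i B \<psi> k"
    by (simp only: local_apply_in[OF fin assms(1) k] sum.distrib)
qed

lemma local_apply_minus:
  assumes "i \<in> I" "A \<in> carrier_mat (d i) (d i)" "B \<in> carrier_mat (d i) (d i)"
  shows "local_apply I d i (A - B) \<psi> = (\<lambda>k. local_apply I d i A \<psi> k - local_apply I d i B \<psi> k)"
proof (rule tensor_space_eqI[OF local_apply_in_tensor_space])
  show "(\<lambda>k. local_apply I d i A \<psi> k - local_apply I d i B \<psi> k) \<in> tensor_space I d"
    using local_apply_in_tensor_space[of I d i A \<psi>] local_apply_in_tensor_space[of I d i B \<psi>]
    by (simp add: tensor_space_def)
  fix k assume k: "k \<in> multi_indices I d"
  have "(\<Sum>a<d i. (A - B) $$ (k i, a) * \<psi> (k(i := a)))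
      = (\<Sum>a<d i. A $$ (k i, a) * \<psi> (k(i := a)) - B $$ (k i, a) * \<psi> (k(i := a)))"
    using multi_indices_remove(2)[OF assms(1) k] assms(2,3)
    by (intro sum.cong) (auto simp: left_diff_distrib)
  then show "local_apply I d i (A - B) \<psi> k = local_apply I d i A \<psi> k - local_apply I d i B \<psi> k"
    by (simp only: local_apply_in[OF fin assms(1) k] sum_subtractf)
qed

lemma local_apply_smult:
  assumes "i \<in> I" "A \<in> carrier_mat (d i) (d i)"
  shows "local_apply I d i (c \<cdot>\<^sub>m A) \<psi> = (\<lambda>k. c * local_apply I d i A \<psi> k)"
proof (rule tensor_space_eqI[OF local_apply_in_tensor_space])
  show "(\<lambda>k. c * local_apply I d i A \<psi> k) \<in> tensor_space I d"
    using local_apply_in_tensor_space[of I d i A \<psi>] by (simp add: tensor_space_def)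
  fix k assume k: "k \<in> multi_indices I d"
  have "(\<Sum>a<d i. (c \<cdot>\<^sub>m A) $$ (k i, a) * \<psi> (k(i := a)))
      = (\<Sum>a<d i. c * (A $$ (k i, a) * \<psi> (k(i := a))))"
    using multi_indices_remove(2)[OF assms(1) k] assms(2)
    by (intro sum.cong) auto
  then show "local_apply I d i (c \<cdot>\<^sub>m A) \<psi> k = c * local_apply I d i A \<psi> k"
    by (simp only: local_apply_in[OF fin assms(1) k] sum_distrib_left)
qed

text \<open>Complementation exchanges the two outcomes, so that facts about \<chi> carry over to
  \<psi> - \<chi>.\<close>

lemma agreeing_projections_complement:
  assumes "agreeing_projections I d \<psi> P \<chi>" "\<psi> \<in> tensor_space I d"
  shows "agreeing_projections I d \<psi> (\<lambda>i. 1\<^sub>m (d i) - P i) (\<lambda>k. \<psi> k - \<chi> k)"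
  unfolding agreeing_projections_def
proof (intro ballI conjI)
  fix i assume i: "i \<in> I"
  with assms(1) have P: "projector (d i) (P i)" "local_apply I d i (P i) \<psi> = \<chi>"
    by (auto simp: agreeing_projections_def)
  then show "projector (d i) (1\<^sub>m (d i) - P i)"
    by (simp add: projector_complement)
  show "local_apply I d i (1\<^sub>m (d i) - P i) \<psi> = (\<lambda>k. \<psi> k - \<chi> k)"
    using local_apply_minus[OF i one_carrier_mat projectorD(1)[OF P(1)], of \<psi>]
    by (simp add: P(2) local_apply_one[OF fin assms(2) i])
qed

lemma agreeing_projections_idem:
  assumes "agreeing_projections I d \<psi> P \<chi>" "i \<in> I"
  shows "local_apply I d i (P i) \<chi> = \<chi>"
proof -
  have P: "projector (d i) (P i)" "local_apply I d i (P i) \<psi> = \<chi>"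
    using assms by (auto simp: agreeing_projections_def)
  have "local_apply I d i (P i) (local_apply I d i (P i) \<psi>) = local_apply I d i (P i) \<psi>"
    using local_apply_mult[of I i "P i" d "P i" \<psi>] assms(2) projectorD(1)[OF P(1)] projectorD(2)[OF P(1)]
    by simp
  then show ?thesis by (simp add: P(2))
qed

text \<open>The projectors are applied one agent after another: the first turns \<psi> into \<chi>,
  each further one fixes \<chi>. The induction starts at a singleton because without any projector
  \<psi> itself would be left.\<close>

lemma tensor_apply_agreeing_projections:
  assumes "agreeing_projections I d \<psi> P \<chi>" "I \<noteq> {}"
  shows "tensor_apply I d P \<psi> = \<chi>"
proof -
  have P: "\<And>i. i \<in> I \<Longrightarrow> P i \<in> carrier_mat (d i) (d i)"
    using assms(1) by (auto simp: agreeing_projections_def projector_def)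
  have "tensor_apply I d (\<lambda>i. if i \<in> S then P i else 1\<^sub>m (d i)) \<psi> = \<chi>"
    if "finite S" "S \<noteq> {}" "S \<subseteq> I" for S
    using that
  proof (induction S rule: finite_ne_induct)
    case (singleton i)
    have "tensor_apply I d (\<lambda>m. if m \<in> {i} then P m else 1\<^sub>m (d m)) \<psi> = local_apply I d i (P i) \<psi>"
      unfolding local_op_def by (rule tensor_apply_cong) auto
    then show ?case using assms(1) singleton by (simp add: agreeing_projections_def)
  next
    case (insert i S)
    let ?A = "\<lambda>m. if m \<in> S then P m else 1\<^sub>m (d m)"
    have i: "i \<in> I" using insert.prems by simp
    have A: "?A m \<in> carrier_mat (d m) (d m)" if "m \<in> I" for m using P[OF that] by simp
    have "tensor_apply I d (\<lambda>m. if m \<in> insert i S then P m else 1\<^sub>m (d m)) \<psi>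
        = tensor_apply I d (?A(i := P i * ?A i)) \<psi>"
      by (rule tensor_apply_cong) (use insert.hyps P[OF i] in auto)
    also have "\<dots> = local_apply I d i (P i) (tensor_apply I d ?A \<psi>)"
      by (rule local_apply_tensor_apply[symmetric]) (use i A P in auto)
    also have "\<dots> = \<chi>"
      using insert.IH insert.prems agreeing_projections_idem[OF assms(1) i] by simp
    finally show ?case .
  qed
  from this[OF fin assms(2)] have "tensor_apply I d (\<lambda>i. if i \<in> I then P i else 1\<^sub>m (d i)) \<psi> = \<chi>"
    by simp
  moreover have "tensor_apply I d P \<psi> = tensor_apply I d (\<lambda>i. if i \<in> I then P i else 1\<^sub>m (d i)) \<psi>"
    by (rule tensor_apply_cong) simp
  ultimately show ?thesis by simp
qed

text \<open>Idempotence permits an extra copy of \<open>A i\<close> next to \<psi>. In this way the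
  factors of two chosen agents can be made to act on \<psi> first.\<close>

lemma tensor_apply_absorb:
  assumes "i \<in> I" "\<And>m. m \<in> I \<Longrightarrow> projector (d m) (A m)"
  shows "tensor_apply I d A (local_apply I d i (A i) \<psi>) = tensor_apply I d A \<psi>"
proof -
  have "tensor_apply I d A (local_apply I d i (A i) \<psi>) = tensor_apply I d (A(i := A i * A i)) \<psi>"
    using assms by (intro tensor_apply_local_apply) (auto simp: projector_def)
  then show ?thesis using projectorD(2)[OF assms(2)[OF assms(1)]] by simp
qed

lemma splittable_imp_GSD:
  assumes "splittable I d \<psi>" "\<psi> \<in> tensor_space I d" "I \<noteq> {}"
  shows "GSD I d \<psi>"
proof -
  obtain P \<chi> where P: "agreeing_projections I d \<psi> P \<chi>" and \<chi>: "\<chi> \<noteq> (\<lambda>k. 0)" "\<chi> \<noteq> \<psi>"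
    using assms(1) by (auto simp: splittable_def)
  define R where "R = (\<lambda>i j. if j = (1::nat) then P i else 1\<^sub>m (d i) - P i)"
  have P': "agreeing_projections I d \<psi> (\<lambda>i. 1\<^sub>m (d i) - P i) (\<lambda>k. \<psi> k - \<chi> k)"
    by (rule agreeing_projections_complement[OF P assms(2)])
  have J: "{1..2::nat} = {1, 2}" by auto
  have R: "agreeing_projections I d \<psi> (\<lambda>i. R i 1) \<chi>" "agreeing_projections I d \<psi> (\<lambda>i. R i 2) (\<lambda>k. \<psi> k - \<chi> k)"
    using P P' by (simp_all add: R_def)
  have "projector (d i) (R i j)" if "i \<in> I" "j \<in> {1..2}" for i j
    using that R unfolding J by (auto simp: agreeing_projections_def)
  moreover have "pairwise_orthogonal (d i) {1..2} (R i)" if "i \<in> I" for i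
    using that P projector_mult_complement[of "d i" "P i"] complement_mult_projector[of "d i" "P i"]
    by (auto simp: pairwise_orthogonal_def agreeing_projections_def J R_def)
  moreover have "local_apply I d i (R i j) \<psi> \<noteq> (\<lambda>k. 0)" if "i \<in> I" "j \<in> {1..2}" for i j
    using that R \<chi> unfolding J by (auto simp: agreeing_projections_def diff_eq_zero_fun_iff)
  moreover have "\<psi> = (\<lambda>k. \<Sum>j\<in>{1..2}. tensor_apply I d (\<lambda>i. R i j) \<psi> k)"
    unfolding J
    using tensor_apply_agreeing_projections[OF R(1) assms(3)]
      tensor_apply_agreeing_projections[OF R(2) assms(3)] by simp
  ultimately show ?thesis
    unfolding GSD_def by (intro exI[of _ 2] exI[of _ R]) auto
qed

lemma outcome_prob_eq_0_iff:
  "outcome_prob I d Q \<psi> s = 0 \<longleftrightarrow> tensor_apply I d (\<lambda>i. Q i (s i)) \<psi> = (\<lambda>k. 0)"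
  using tnorm_eq_0_iff[OF fin tensor_apply_in_tensor_space] by (simp add: outcome_prob_def)

lemma splittable_imp_consensus:
  assumes "splittable I d \<psi>" "\<psi> \<in> tensor_space I d" "I \<noteq> {}"
  shows "\<exists>(J :: nat set) Q. totally_correct_consensus I d \<psi> J Q"
proof -
  obtain P \<chi> where P: "agreeing_projections I d \<psi> P \<chi>" and \<chi>: "\<chi> \<noteq> (\<lambda>k. 0)" "\<chi> \<noteq> \<psi>"
    using assms(1) by (auto simp: splittable_def)
  define Q where "Q = (\<lambda>i j. if j = (0::nat) then P i else 1\<^sub>m (d i) - P i)"
  have P': "agreeing_projections I d \<psi> (\<lambda>i. 1\<^sub>m (d i) - P i) (\<lambda>k. \<psi> k - \<chi> k)"
    by (rule agreeing_projections_complement[OF P assms(2)])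
  have Q: "agreeing_projections I d \<psi> (\<lambda>i. Q i 0) \<chi>" "agreeing_projections I d \<psi> (\<lambda>i. Q i 1) (\<lambda>k. \<psi> k - \<chi> k)"
    using P P' by (simp_all add: Q_def)
  have proj: "projector (d i) (Q i j)" if "i \<in> I" "j \<in> {0, 1}" for i j
    using that Q by (auto simp: agreeing_projections_def)
  have orth: "pairwise_orthogonal (d i) {0, 1} (Q i)" if "i \<in> I" for i
    using that P projector_mult_complement[of "d i" "P i"] complement_mult_projector[of "d i" "P i"]
    by (auto simp: pairwise_orthogonal_def agreeing_projections_def Q_def)
  have "mat (d i) (d i) (\<lambda>(a, b). \<Sum>j\<in>{0, 1}. Q i j $$ (a, b)) = 1\<^sub>m (d i)" if "i \<in> I" for i
    using that projectorD(1)[OF proj[OF that, of 0]] by (intro eq_matI) (auto simp: Q_def)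
  then have "protocol I d {0, 1} Q"
    using proj orth by (simp add: protocol_def projective_measurement_def)
  moreover have "s i = s m"
    if s: "s \<in> I \<rightarrow>\<^sub>E {0, 1}" "outcome_prob I d Q \<psi> s \<noteq> 0" and im: "i \<in> I" "m \<in> I" for s i m
  proof (rule ccontr)
    assume neq: "s i \<noteq> s m"
    let ?A = "\<lambda>i. Q i (s i)"
    have sI: "s l \<in> {0, 1}" if "l \<in> I" for l using s(1) that by (auto simp: PiE_def)
    have A: "projector (d l) (?A l)" if "l \<in> I" for l using proj[OF that sI[OF that]] .
    \<comment> \<open>For a given label all agents project \<psi> to the same vector, so the
      projector of i may be replaced by that of m with the label of i. Then two orthogonal
      projectors of m meet.\<close>
    have *: "local_apply I d i (Q i j) \<psi> = local_apply I d m (Q m j) \<psi>" if "j \<in> {0, 1}" for j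
      using Q im that by (auto simp: agreeing_projections_def)
    have "local_apply I d m (?A m) (local_apply I d i (?A i) \<psi>)
        = local_apply I d m (?A m) (local_apply I d m (Q m (s i)) \<psi>)"
      using *[OF sI[OF im(1)]] by simp
    also have "\<dots> = local_apply I d m (Q m (s m) * Q m (s i)) \<psi>"
      by (rule local_apply_mult) (use proj im sI in \<open>auto simp: projector_def\<close>)
    also have "Q m (s m) * Q m (s i) = 0\<^sub>m (d m) (d m)"
      using orth[OF im(2)] neq sI[OF im(1)] sI[OF im(2)]
      unfolding pairwise_orthogonal_def by metis
    also have "local_apply I d m (0\<^sub>m (d m) (d m)) \<psi> = (\<lambda>k. 0)"
      by (rule local_apply_zero[OF fin im(2)])
    \<comment> \<open>By absorption the outcome operator may be preceded by these two factors, so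
      its amplitude vanishes as well.\<close>
    finally have "tensor_apply I d ?A (local_apply I d m (?A m) (local_apply I d i (?A i) \<psi>)) = (\<lambda>k. 0)"
      by (simp add: op_apply_zero)
    then have "tensor_apply I d ?A \<psi> = (\<lambda>k. 0)"
      using tensor_apply_absorb[of m ?A "local_apply I d i (?A i) \<psi>"] tensor_apply_absorb[of i ?A \<psi>] A im
      by simp
    then show False using s(2) by (simp add: outcome_prob_eq_0_iff)
  qed
  moreover have "outcome_prob I d Q \<psi> (\<lambda>i\<in>I. j) \<noteq> 0" if "j \<in> {0, 1}" for j
  proof -
    have eq: "tensor_apply I d (\<lambda>i. Q i ((\<lambda>i\<in>I. j) i)) \<psi> = tensor_apply I d (\<lambda>i. Q i j) \<psi>"
      by (rule tensor_apply_cong) simp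
    have "tensor_apply I d (\<lambda>i. Q i j) \<psi> \<noteq> (\<lambda>k. 0)"
      using that
    proof (elim insertE emptyE)
      show "tensor_apply I d (\<lambda>i. Q i j) \<psi> \<noteq> (\<lambda>k. 0)" if "j = 0"
        using that \<chi>(1) tensor_apply_agreeing_projections[OF Q(1) assms(3)] by simp
      show "tensor_apply I d (\<lambda>i. Q i j) \<psi> \<noteq> (\<lambda>k. 0)" if "j = 1"
        unfolding that tensor_apply_agreeing_projections[OF Q(2) assms(3)]
        using \<chi>(2) by (simp add: diff_eq_zero_fun_iff)
    qed
    then show ?thesis unfolding outcome_prob_eq_0_iff eq .
  qed
  ultimately have "totally_correct_consensus I d \<psi> {0, 1} Q"
    unfolding totally_correct_consensus_def by (auto intro: bexI[of _ 0] bexI[of _ 1])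
  then show ?thesis by blast
qed

text \<open>If \<chi> were all of \<psi>, then \<eta>, which is \<open>R i * P i\<close> applied to
  \<psi>, would vanish. Decompositions and protocols both supply two such orthogonal
  families.\<close>

lemma orthogonal_projections_imp_splittable:
  assumes P: "agreeing_projections I d \<psi> P \<chi>" and R: "agreeing_projections I d \<psi> R \<eta>"
    and "\<chi> \<noteq> (\<lambda>k. 0)" "\<eta> \<noteq> (\<lambda>k. 0)" and i: "i \<in> I" "R i * P i = 0\<^sub>m (d i) (d i)"
  shows "splittable I d \<psi>"
proof -
  have "\<chi> \<noteq> \<psi>"
  proof
    assume "\<chi> = \<psi>"
    then have "\<eta> = local_apply I d i (R i) (local_apply I d i (P i) \<psi>)"
      using P R i by (auto simp: agreeing_projections_def)
    also have "\<dots> = local_apply I d i (R i * P i) \<psi>"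
      using P R i(1) by (intro local_apply_mult) (auto simp: agreeing_projections_def projector_def)
    also have "\<dots> = (\<lambda>k. 0)"
      unfolding i(2) by (rule local_apply_zero[OF fin i(1)])
    finally show False using assms(4) by simp
  qed
  then show ?thesis using P assms(3) by (auto simp: splittable_def)
qed

lemma GSD_imp_splittable:
  assumes "GSD I d \<psi>" "I \<noteq> {}"
  shows "splittable I d \<psi>"
proof -
  obtain L :: nat and P where L: "L > 1"
    and proj: "\<And>i j. i \<in> I \<Longrightarrow> j \<in> {1..L} \<Longrightarrow> projector (d i) (P i j)"
    and orth: "\<And>i. i \<in> I \<Longrightarrow> pairwise_orthogonal (d i) {1..L} (P i)"
    and nz: "\<And>i j. i \<in> I \<Longrightarrow> j \<in> {1..L} \<Longrightarrow> local_apply I d i (P i j) \<psi> \<noteq> (\<lambda>k. 0)"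
    and dec: "\<psi> = (\<lambda>k. \<Sum>j\<in>{1..L}. tensor_apply I d (\<lambda>i. P i j) \<psi> k)"
    using assms(1) unfolding GSD_def by blast
  \<comment> \<open>Applied to the decomposition, \<open>P i j\<close> kills every summand but the
    j-th by orthogonality and fixes that one by idempotence.\<close>
  have agree: "local_apply I d i (P i j) \<psi> = tensor_apply I d (\<lambda>i. P i j) \<psi>"
    if i: "i \<in> I" and j: "j \<in> {1..L}" for i j
  proof -
    have *: "local_apply I d i (P i j) (tensor_apply I d (\<lambda>i. P i l) \<psi>)
        = (if l = j then tensor_apply I d (\<lambda>i. P i j) \<psi> else (\<lambda>k. 0))" if l: "l \<in> {1..L}" for l
    proof -
      have "local_apply I d i (P i j) (tensor_apply I d (\<lambda>i. P i l) \<psi>)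
          = tensor_apply I d ((\<lambda>i. P i l)(i := P i j * P i l)) \<psi>"
        by (rule local_apply_tensor_apply) (use proj i j l in \<open>auto simp: projector_def\<close>)
      also have "\<dots> = (if l = j then tensor_apply I d (\<lambda>i. P i j) \<psi> else (\<lambda>k. 0))"
      proof (cases "l = j")
        case True
        then show ?thesis
          using projectorD(2)[OF proj[OF i j]] by (auto intro!: tensor_apply_cong)
      next
        case False
        then have "P i j * P i l = 0\<^sub>m (d i) (d i)"
          using orth[OF i] j l by (auto simp: pairwise_orthogonal_def)
        then show ?thesis using False i by (simp add: tensor_apply_eq_0[of _ i])
      qed
      finally show ?thesis .
    qed
    have "local_apply I d i (P i j) \<psi>
        = (\<lambda>k. \<Sum>l\<in>{1..L}. local_apply I d i (P i j) (tensor_apply I d (\<lambda>i. P i l) \<psi>) k)"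
      by (subst dec) (rule op_apply_sum)
    also have "\<dots> = (\<lambda>k. \<Sum>l\<in>{1..L}. if l = j then tensor_apply I d (\<lambda>i. P i j) \<psi> k else 0)"
      by (intro ext sum.cong refl) (simp add: *)
    also have "\<dots> = tensor_apply I d (\<lambda>i. P i j) \<psi>"
      using j by simp
    finally show ?thesis .
  qed
  obtain i where i: "i \<in> I" using assms(2) by blast
  have ag: "agreeing_projections I d \<psi> (\<lambda>i. P i j) (tensor_apply I d (\<lambda>i. P i j) \<psi>)"
    and "tensor_apply I d (\<lambda>i. P i j) \<psi> \<noteq> (\<lambda>k. 0)" if "j \<in> {1..L}" for j
    using that proj agree nz[OF i that] i by (auto simp: agreeing_projections_def)
  moreover have "P i 2 * P i 1 = 0\<^sub>m (d i) (d i)"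
    using orth[OF i] L by (auto simp: pairwise_orthogonal_def)
  moreover have "1 \<in> {1..L}" "2 \<in> {1..L}" using L by auto
  ultimately show ?thesis
    using i orthogonal_projections_imp_splittable[of \<psi> "\<lambda>i. P i 1" _ "\<lambda>i. P i 2" _ i] by blast
qed

text \<open>The projection by a single agent is the sum of the amplitudes of all joint outcomes in
  which this agent announces j. Total correctness leaves only the unanimous outcome, so the result
  is the same for all agents.\<close>

lemma consensus_imp_splittable:
  assumes cons: "totally_correct_consensus I d \<psi> J Q" and \<psi>: "\<psi> \<in> tensor_space I d" and ne: "I \<noteq> {}"
  shows "splittable I d \<psi>"
proof -
  have finJ: "finite J" and proj: "\<And>i j. i \<in> I \<Longrightarrow> j \<in> J \<Longrightarrow> projector (d i) (Q i j)"
    and orth: "\<And>i. i \<in> I \<Longrightarrow> pairwise_orthogonal (d i) J (Q i)"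
    and compl: "\<And>i. i \<in> I \<Longrightarrow> mat (d i) (d i) (\<lambda>(a, b). \<Sum>j\<in>J. Q i j $$ (a, b)) = 1\<^sub>m (d i)"
    and agree: "\<And>s i m. s \<in> I \<rightarrow>\<^sub>E J \<Longrightarrow> outcome_prob I d Q \<psi> s \<noteq> 0 \<Longrightarrow> i \<in> I \<Longrightarrow> m \<in> I \<Longrightarrow> s i = s m"
    using cons unfolding totally_correct_consensus_def protocol_def projective_measurement_def by blast+
  obtain a b where ab: "a \<in> J" "b \<in> J" "a \<noteq> b"
    and pa: "outcome_prob I d Q \<psi> (\<lambda>i\<in>I. a) \<noteq> 0" and pb: "outcome_prob I d Q \<psi> (\<lambda>i\<in>I. b) \<noteq> 0"
    using cons unfolding totally_correct_consensus_def by blast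
  have const: "tensor_apply I d (\<lambda>i. Q i ((\<lambda>i\<in>I. j) i)) \<psi> = tensor_apply I d (\<lambda>i. Q i j) \<psi>" for j
    by (rule tensor_apply_cong) simp
  have local_eq: "local_apply I d i (Q i j) \<psi> = tensor_apply I d (\<lambda>i. Q i j) \<psi>"
    if i: "i \<in> I" and j: "j \<in> J" for i j
  proof (rule tensor_space_eqI[OF local_apply_in_tensor_space tensor_apply_in_tensor_space])
    fix k assume k: "k \<in> multi_indices I d"
    \<comment> \<open>Agent i is restricted to the outcome j, while the identities of the other
      agents are expanded over all of J by the completeness relation.\<close>
    let ?S = "\<lambda>m. if m = i then {j} else J"
    have entry: "(if m = i then Q i j else 1\<^sub>m (d m)) $$ (k m, l m) = (\<Sum>x\<in>?S m. Q m x $$ (k m, l m))"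
      if m: "m \<in> I" and l: "l \<in> multi_indices I d" for m l
    proof (cases "m = i")
      case False
      have "k m < d m" "l m < d m"
        using multi_indices_remove(2)[OF m k] multi_indices_remove(2)[OF m l] .
      then show ?thesis
        using False arg_cong[OF compl[OF m], of "\<lambda>A. A $$ (k m, l m)"] by simp
    qed simp
    have "local_apply I d i (Q i j) \<psi> k
        = (\<Sum>l\<in>multi_indices I d. (\<Prod>m\<in>I. \<Sum>x\<in>?S m. Q m x $$ (k m, l m)) * \<psi> l)"
      unfolding local_op_def tensor_apply_in[OF k]
      by (intro sum.cong refl arg_cong2[of _ _ _ _ times] prod.cong entry)
    also have "\<dots> = (\<Sum>l\<in>multi_indices I d. (\<Sum>s\<in>PiE I ?S. \<Prod>m\<in>I. Q m (s m) $$ (k m, l m)) * \<psi> l)"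
      using finJ by (simp add: prod_sum_PiE)
    also have "\<dots> = (\<Sum>s\<in>PiE I ?S. tensor_apply I d (\<lambda>i. Q i (s i)) \<psi> k)"
      unfolding tensor_apply_in[OF k] sum_distrib_right by (rule sum.swap)
    also have "\<dots> = (\<Sum>s\<in>{\<lambda>i\<in>I. j}. tensor_apply I d (\<lambda>i. Q i (s i)) \<psi> k)"
    proof (rule sum.mono_neutral_right)
      show "finite (PiE I ?S)" using finJ by (intro finite_PiE) auto
      show "{\<lambda>i\<in>I. j} \<subseteq> PiE I ?S" using j by auto
      show "\<forall>s\<in>PiE I ?S - {\<lambda>i\<in>I. j}. tensor_apply I d (\<lambda>i. Q i (s i)) \<psi> k = 0"
      proof
        fix s assume s: "s \<in> PiE I ?S - {\<lambda>i\<in>I. j}"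
        have sJ: "s \<in> I \<rightarrow>\<^sub>E J" using s j by (auto simp: PiE_def Pi_def split: if_splits)
        have si: "s i = j" using s i by (auto simp: PiE_def Pi_def)
        have "\<exists>m\<in>I. s m \<noteq> j"
        proof (rule ccontr)
          assume "\<not> (\<exists>m\<in>I. s m \<noteq> j)"
          then have "s = (\<lambda>i\<in>I. j)" using sJ by (auto simp: PiE_def extensional_def fun_eq_iff)
          then show False using s by simp
        qed
        then have "outcome_prob I d Q \<psi> s = 0"
          using agree[OF sJ] i si by metis
        then show "tensor_apply I d (\<lambda>i. Q i (s i)) \<psi> k = 0"
          unfolding outcome_prob_eq_0_iff by metis
      qed
    qed
    also have "\<dots> = tensor_apply I d (\<lambda>i. Q i j) \<psi> k"
      by (simp only: sum.insert finite.emptyI empty_iff sum.empty add_0_right simp_thms const)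
    finally show "local_apply I d i (Q i j) \<psi> k = tensor_apply I d (\<lambda>i. Q i j) \<psi> k" .
  qed
  obtain i where i: "i \<in> I" using ne by blast
  have "agreeing_projections I d \<psi> (\<lambda>i. Q i j) (tensor_apply I d (\<lambda>i. Q i j) \<psi>)" if "j \<in> J" for j
    using that proj local_eq by (auto simp: agreeing_projections_def)
  moreover have "Q i b * Q i a = 0\<^sub>m (d i) (d i)"
    using orth[OF i] ab by (auto simp: pairwise_orthogonal_def)
  ultimately show ?thesis
    using ab i pa pb unfolding outcome_prob_eq_0_iff const
    by (blast intro: orthogonal_projections_imp_splittable)
qed

end

section \<open>States with the same partial traces\<close>

context
  fixes I :: "nat set" and d :: "nat \<Rightarrow> nat" and i :: nat and h :: "nat \<Rightarrow> multi_index" and r :: nat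
  assumes fin [simp]: "finite I" and i [simp]: "i \<in> I"
    and h: "bij_betw h {..<r} (multi_indices (I - {i}) d)"
begin

text \<open>The reshaping of \<psi> into an operator from the other particles to particle i. The
  bijection \<open>h\<close> numbers the multi-indices of the other particles, so that they can
  serve as columns.\<close>

definition slice :: "tvec \<Rightarrow> complex mat" where
  "slice \<psi> = mat (d i) r (\<lambda>(a, c). \<psi> ((h c)(i := a)))"

lemma slice_carrier [simp]: "slice \<psi> \<in> carrier_mat (d i) r"
  by (simp add: slice_def)

lemma h_in: "c < r \<Longrightarrow> h c \<in> multi_indices (I - {i}) d"
  using h by (auto simp: bij_betw_def)

lemma slice_local_apply:
  assumes "W \<in> carrier_mat (d i) (d i)"
  shows "slice (local_apply I d i W \<psi>) = W * slice \<psi>"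
proof (rule eq_matI)
  fix a c assume "a < dim_row (W * slice \<psi>)" "c < dim_col (W * slice \<psi>)"
  then have a: "a < d i" and c: "c < r" using assms by (auto simp: slice_def)
  have k: "(h c)(i := a) \<in> multi_indices I d"
    using h_in[OF c] a by (intro multi_indices_upd) auto
  show "slice (local_apply I d i W \<psi>) $$ (a, c) = (W * slice \<psi>) $$ (a, c)"
    using a c assms by (simp add: slice_def local_apply_in[OF fin i k] scalar_prod_def lessThan_atLeast0)
qed (use assms in \<open>auto simp: slice_def\<close>)

lemma slice_inject:
  assumes "\<phi> \<in> tensor_space I d" "\<psi> \<in> tensor_space I d" "slice \<phi> = slice \<psi>"
  shows "\<phi> = \<psi>"
proof (rule tensor_space_eqI[OF assms(1,2)])
  fix k assume k: "k \<in> multi_indices I d"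
  note kr = multi_indices_remove[OF i k]
  obtain c where c: "c < r" "h c = k(i := undefined)"
    using h kr(1) by (metis bij_betw_iff_bijections lessThan_iff)
  have "slice \<phi> $$ (k i, c) = slice \<psi> $$ (k i, c)" using assms(3) by simp
  then show "\<phi> k = \<psi> k" using c kr(2) by (simp add: slice_def)
qed

text \<open>The Gram matrix of the columns is the transpose of the partial trace, whence the
  exchanged arguments \<open>h c'\<close> and \<open>h c\<close>.\<close>

lemma slice_gram_col:
  assumes "c < r" "c' < r"
  shows "(mat_adjoint (slice \<psi>) * slice \<psi>) $$ (c, c') = partial_trace I d i (ketbra \<psi> \<psi>) (h c') (h c)"
  using assms h_in
  by (simp add: slice_def scalar_prod_def partial_trace_def ketbra_def lessThan_atLeast0 mult.commute)

lemma partial_trace_eq_iff: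
  "partial_trace I d i (ketbra \<psi> \<psi>) = partial_trace I d i (ketbra \<phi> \<phi>)
    \<longleftrightarrow> mat_adjoint (slice \<psi>) * slice \<psi> = mat_adjoint (slice \<phi>) * slice \<phi>"
proof
  assume eq: "partial_trace I d i (ketbra \<psi> \<psi>) = partial_trace I d i (ketbra \<phi> \<phi>)"
  show "mat_adjoint (slice \<psi>) * slice \<psi> = mat_adjoint (slice \<phi>) * slice \<phi>"
  proof (rule eq_matI)
    fix c c' assume "c < dim_row (mat_adjoint (slice \<phi>) * slice \<phi>)" "c' < dim_col (mat_adjoint (slice \<phi>) * slice \<phi>)"
    then have "c < r" "c' < r" by (auto simp: slice_def)
    then show "(mat_adjoint (slice \<psi>) * slice \<psi>) $$ (c, c') = (mat_adjoint (slice \<phi>) * slice \<phi>) $$ (c, c')"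
      by (simp only: slice_gram_col eq)
  qed (auto simp: slice_def)
next
  assume eq: "mat_adjoint (slice \<psi>) * slice \<psi> = mat_adjoint (slice \<phi>) * slice \<phi>"
  show "partial_trace I d i (ketbra \<psi> \<psi>) = partial_trace I d i (ketbra \<phi> \<phi>)"
  proof (intro ext)
    fix k l
    show "partial_trace I d i (ketbra \<psi> \<psi>) k l = partial_trace I d i (ketbra \<phi> \<phi>) k l"
    \<comment> \<open>Only arguments enumerated by \<open>h\<close> carry information; elsewhere
      both partial traces are 0 by definition.\<close>
    proof (cases "k \<in> multi_indices (I - {i}) d \<and> l \<in> multi_indices (I - {i}) d")
      case True
      then obtain c c' where c: "c < r" "c' < r" and "k = h c'" "l = h c"
        using h unfolding bij_betw_def by (metis (no_types, lifting) imageE lessThan_iff)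
      then show ?thesis
        by (simp only: slice_gram_col[OF c, symmetric] eq)
    qed (auto simp: partial_trace_def)
  qed
qed

text \<open>The Gram matrix of the rows is the reduced state of particle i alone. It arises from the
  partial trace over any other particle m by tracing out the remaining ones.\<close>

lemma slice_gram_row:
  assumes m: "m \<in> I" "m \<noteq> i"
    and eq: "partial_trace I d m (ketbra \<psi> \<psi>) = partial_trace I d m (ketbra \<phi> \<phi>)"
  shows "slice \<psi> * mat_adjoint (slice \<psi>) = slice \<phi> * mat_adjoint (slice \<phi>)"
proof -
  have *: "(slice \<xi> * mat_adjoint (slice \<xi>)) $$ (a, b)
      = (\<Sum>k\<in>multi_indices (I - {i} - {m}) d. partial_trace I d m (ketbra \<xi> \<xi>) (k(i := a)) (k(i := b)))"
    if ab: "a < d i" "b < d i" for \<xi> a b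
  proof -
    have "(slice \<xi> * mat_adjoint (slice \<xi>)) $$ (a, b)
        = (\<Sum>c<r. \<xi> ((h c)(i := a)) * cnj (\<xi> ((h c)(i := b))))"
      using ab by (simp add: slice_def scalar_prod_def lessThan_atLeast0)
    also have "\<dots> = (\<Sum>k\<in>multi_indices (I - {i}) d. \<xi> (k(i := a)) * cnj (\<xi> (k(i := b))))"
      by (rule sum.reindex_bij_betw[OF h])
    \<comment> \<open>Splitting off the coordinate m exposes the partial trace over m, taken at
      indices that agree outside i.\<close>
    also have "\<dots> = (\<Sum>k\<in>multi_indices (I - {i} - {m}) d. \<Sum>c<d m.
        \<xi> (k(m := c, i := a)) * cnj (\<xi> (k(m := c, i := b))))"
      using m by (intro sum_multi_indices_remove) auto
    also have "\<dots> = (\<Sum>k\<in>multi_indices (I - {i} - {m}) d.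
        partial_trace I d m (ketbra \<xi> \<xi>) (k(i := a)) (k(i := b)))"
    proof (rule sum.cong[OF refl])
      fix k assume "k \<in> multi_indices (I - {i} - {m}) d"
      then have "k \<in> multi_indices (I - {m} - {i}) d"
        by (simp add: Diff_insert2[symmetric] insert_commute Diff_insert[symmetric])
      then have "k(i := a) \<in> multi_indices (I - {m}) d" "k(i := b) \<in> multi_indices (I - {m}) d"
        using m ab by (auto intro!: multi_indices_upd)
      then show "(\<Sum>c<d m. \<xi> (k(m := c, i := a)) * cnj (\<xi> (k(m := c, i := b))))
          = partial_trace I d m (ketbra \<xi> \<xi>) (k(i := a)) (k(i := b))"
        using m by (simp add: partial_trace_def ketbra_def fun_upd_twist)
    qed
    finally show ?thesis .
  qed
  show ?thesis
  proof (rule eq_matI)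
    fix a b assume "a < dim_row (slice \<phi> * mat_adjoint (slice \<phi>))" "b < dim_col (slice \<phi> * mat_adjoint (slice \<phi>))"
    then have "a < d i" "b < d i" by (auto simp: slice_def)
    then show "(slice \<psi> * mat_adjoint (slice \<psi>)) $$ (a, b) = (slice \<phi> * mat_adjoint (slice \<phi>)) $$ (a, b)"
      by (simp only: * eq)
  qed (auto simp: slice_def)
qed

text \<open>The squared norm is the trace of the reduced operator, so vectors with the same partial
  trace have the same norm.\<close>

lemma tnorm_partial_trace:
  "(tnorm I d \<psi>)\<^sup>2 = Re (\<Sum>k\<in>multi_indices (I - {i}) d. partial_trace I d i (ketbra \<psi> \<psi>) k k)"
proof -
  have "complex_of_real ((tnorm I d \<psi>)\<^sup>2) = (\<Sum>k\<in>multi_indices I d. cnj (\<psi> k) * \<psi> k)"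
    by (simp only: tinner_self[symmetric] tinner_def)
  also have "\<dots> = (\<Sum>k\<in>multi_indices (I - {i}) d. partial_trace I d i (ketbra \<psi> \<psi>) k k)"
    unfolding sum_multi_indices_remove[OF i]
    by (intro sum.cong refl) (simp add: partial_trace_def ketbra_def mult.commute)
  finally show ?thesis by (metis Re_complex_of_real)
qed

end

section \<open>One-particle operators and partial traces\<close>

lemma ex_multi_indices_enum:
  assumes "finite I"
  obtains h :: "nat \<Rightarrow> multi_index" and r where "bij_betw h {..<r} (multi_indices I d)"
  using ex_bij_betw_nat_finite[OF finite_multi_indices[OF assms, of d]] by (auto simp: lessThan_atLeast0)

text \<open>The partial trace over i gives equal column Gram matrices of the two slices, the one
  over the second particle m equal row Gram matrices. \<open>ex_normal_mat_mult_eq\<close> takes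
  both.\<close>

lemma ex_normal_local_apply_eq:
  assumes fin: "finite I" and i: "i \<in> I" and m: "m \<in> I" "m \<noteq> i"
    and sp: "\<psi> \<in> tensor_space I d" "\<phi> \<in> tensor_space I d"
    and eqi: "partial_trace I d i (ketbra \<psi> \<psi>) = partial_trace I d i (ketbra \<phi> \<phi>)"
    and eqm: "partial_trace I d m (ketbra \<psi> \<psi>) = partial_trace I d m (ketbra \<phi> \<phi>)"
  obtains W where "W \<in> carrier_mat (d i) (d i)" "normal_mat W" "local_apply I d i W \<psi> = \<phi>"
proof -
  have "finite (I - {i})" using fin by simp
  then obtain h :: "nat \<Rightarrow> multi_index" and r where h: "bij_betw h {..<r} (multi_indices (I - {i}) d)"
    by (rule ex_multi_indices_enum)
  obtain W where W: "W \<in> carrier_mat (d i) (d i)" "normal_mat W"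
      "W * slice d i h r \<psi> = slice d i h r \<phi>"
    by (rule ex_normal_mat_mult_eq[OF slice_carrier[OF fin i h] slice_carrier[OF fin i h]
          partial_trace_eq_iff[OF fin i h, THEN iffD1, OF eqi] slice_gram_row[OF fin i h m eqm]])
  have "local_apply I d i W \<psi> = \<phi>"
    by (rule slice_inject[OF fin i h local_apply_in_tensor_space sp(2)])
      (simp only: slice_local_apply[OF fin i h W(1)] W(3))
  then show ?thesis using that W by blast
qed

text \<open>On the slice, U acts as a left factor, which cancels in the Gram matrix of the
  columns.\<close>

lemma partial_trace_local_apply_unitary:
  assumes fin: "finite I" and i: "i \<in> I"
    and U: "U \<in> carrier_mat (d i) (d i)" "mat_adjoint U * U = 1\<^sub>m (d i)"
  shows "partial_trace I d i (ketbra \<psi> \<psi>)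
    = partial_trace I d i (ketbra (local_apply I d i U \<psi>) (local_apply I d i U \<psi>))"
proof -
  have "finite (I - {i})" using fin by simp
  then obtain h :: "nat \<Rightarrow> multi_index" and r where h: "bij_betw h {..<r} (multi_indices (I - {i}) d)"
    by (rule ex_multi_indices_enum)
  define S where "S = slice d i h r \<psi>"
  have S: "S \<in> carrier_mat (d i) r" unfolding S_def by (rule slice_carrier[OF fin i h])
  have "mat_adjoint (U * S) * (U * S) = mat_adjoint S * mat_adjoint U * (U * S)"
    by (simp only: mat_adjoint_mult[OF U(1) S])
  also have "\<dots> = mat_adjoint S * (mat_adjoint U * (U * S))"
    using U(1) S by (intro assoc_mult_mat) (auto intro: mult_carrier_mat)
  also have "mat_adjoint U * (U * S) = mat_adjoint U * U * S"
    using U(1) S by (intro assoc_mult_mat[symmetric]) auto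
  also have "\<dots> = S" unfolding U(2) by (rule left_mult_one_mat[OF S])
  finally show ?thesis
    unfolding partial_trace_eq_iff[OF fin i h] slice_local_apply[OF fin i h U(1)]
    by (simp add: S_def)
qed

text \<open>U is 1 - 2 P, written as a difference of complementary projectors: the mixed products
  vanish and the squares add up to the identity.\<close>

lemma reflection_unitary:
  assumes "projector n P"
  defines "U \<equiv> (1\<^sub>m n - P) - P"
  shows "U \<in> carrier_mat n n" "mat_adjoint U * U = 1\<^sub>m n"
proof -
  define R where "R = 1\<^sub>m n - P"
  note P = projectorD[OF assms(1)]
  note R = projectorD[OF projector_complement[OF assms(1)], folded R_def]
  have PR: "P * R = 0\<^sub>m n n" "R * P = 0\<^sub>m n n"
    using projector_mult_complement[OF assms(1)] complement_mult_projector[OF assms(1)]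
    by (simp_all add: R_def)
  show U: "U \<in> carrier_mat n n"
    unfolding U_def by (rule minus_carrier_mat[OF P(1)])
  have "mat_adjoint U = R - P"
    using P R unfolding U_def R_def[symmetric] by (simp add: mat_adjoint_minus[OF R(1) P(1)])
  then have "mat_adjoint U * U = (R - P) * (R - P)"
    by (simp add: U_def R_def)
  also have "\<dots> = R * (R - P) - P * (R - P)"
    by (rule minus_mult_distrib_mat[OF R(1) P(1) minus_carrier_mat[OF P(1)]])
  also have "R * (R - P) = R * R - R * P"
    by (rule mult_minus_distrib_mat[OF R(1) R(1) P(1)])
  also have "P * (R - P) = P * R - P * P"
    by (rule mult_minus_distrib_mat[OF P(1) R(1) P(1)])
  also have "R * R - R * P - (P * R - P * P) = 1\<^sub>m n"
    unfolding PR P(2) R(2) unfolding R_def by (rule eq_matI) (use P(1) in auto)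
  finally show "mat_adjoint U * U = 1\<^sub>m n" .
qed

text \<open>The vector \<phi> = \<psi> - 2 \<chi> has overlap q - p with \<psi>, where p and q are
  the squared norms of \<chi> and \<psi> - \<chi>. Both are positive and they add up to 1, so the
  overlap has modulus less than 1.\<close>

lemma splittable_imp_locally_undetermined:
  assumes fin: "finite I" and ne: "I \<noteq> {}" and pure: "pure_state I d \<psi>" and "splittable I d \<psi>"
  shows "locally_undetermined I d \<psi>"
proof -
  have \<psi>: "\<psi> \<in> tensor_space I d" "tnorm I d \<psi> = 1" using pure by (auto simp: pure_state_def)
  obtain P \<chi> where P: "agreeing_projections I d \<psi> P \<chi>" and \<chi>: "\<chi> \<noteq> (\<lambda>k. 0)" "\<chi> \<noteq> \<psi>"
    using assms(4) by (auto simp: splittable_def)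
  define \<eta> where "\<eta> = (\<lambda>k. \<psi> k - \<chi> k)"
  define \<phi> where "\<phi> = (\<lambda>k. \<eta> k - \<chi> k)"
  have R: "agreeing_projections I d \<psi> (\<lambda>i. 1\<^sub>m (d i) - P i) \<eta>"
    unfolding \<eta>_def by (rule agreeing_projections_complement[OF fin P \<psi>(1)])
  obtain i where i: "i \<in> I" using ne by blast
  \<comment> \<open>Since \<open>T i\<close> fixes \<xi>, moving it to the other argument turns
    \<psi> into \<xi>. An arbitrary agreeing family is taken so that the fact serves \<chi> and
    \<eta> alike.\<close>
  have norm_eq: "tinner I d \<xi> \<psi> = of_real ((tnorm I d \<xi>)\<^sup>2) \<and> \<xi> \<in> tensor_space I d"
    if "agreeing_projections I d \<psi> T \<xi>" for T \<xi>
  proof -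
    have T: "projector (d i) (T i)" "local_apply I d i (T i) \<psi> = \<xi>"
      using that i by (auto simp: agreeing_projections_def)
    have "tinner I d \<xi> \<psi> = tinner I d (local_apply I d i (T i) \<xi>) \<psi>"
      using agreeing_projections_idem[OF fin that i] by simp
    also have "\<dots> = tinner I d \<xi> (local_apply I d i (mat_adjoint (T i)) \<psi>)"
      using T by (intro tinner_local_apply[OF fin i]) (auto simp: projector_def)
    also have "\<dots> = tinner I d \<xi> \<xi>"
      using T by (simp add: projector_def)
    finally show ?thesis
      using local_apply_in_tensor_space[of I d i "T i" \<psi>] T(2) by (simp add: tinner_self)
  qed
  define p q where "p = (tnorm I d \<chi>)\<^sup>2" and "q = (tnorm I d \<eta>)\<^sup>2"
  have "tnorm I d \<chi> \<noteq> 0" "tnorm I d \<eta> \<noteq> 0"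
    using norm_eq[OF P] norm_eq[OF R] \<chi>
    by (auto simp: tnorm_eq_0_iff[OF fin] \<eta>_def diff_eq_zero_fun_iff)
  then have pq: "p > 0" "q > 0" by (simp_all add: p_def q_def)
  have "tinner I d \<eta> \<psi> = tinner I d \<psi> \<psi> - tinner I d \<chi> \<psi>"
    unfolding \<eta>_def by (rule tinner_diff_left)
  then have "complex_of_real q = of_real (1 - p)"
    using norm_eq[OF P] norm_eq[OF R] by (simp add: tinner_self \<psi>(2) p_def q_def)
  then have q: "q = 1 - p" by (simp only: of_real_eq_iff)
  have "tinner I d \<phi> \<psi> = of_real (q - p)"
    unfolding \<phi>_def tinner_diff_left using norm_eq[OF P] norm_eq[OF R] by (simp add: p_def q_def)
  then have overlap: "cmod (tinner I d \<phi> \<psi>) \<noteq> 1"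
    using pq q by (simp add: norm_of_real del: of_real_diff)
  \<comment> \<open>Every agent m reaches the same \<phi> by a reflection of its own particle, so
    each partial trace is preserved.\<close>
  have pt: "partial_trace I d m (ketbra \<psi> \<psi>) = partial_trace I d m (ketbra \<phi> \<phi>)" if m: "m \<in> I" for m
  proof -
    have Pm: "projector (d m) (P m)" "local_apply I d m (P m) \<psi> = \<chi>"
      and Rm: "local_apply I d m (1\<^sub>m (d m) - P m) \<psi> = \<eta>"
      using P R m by (auto simp: agreeing_projections_def)
    have "local_apply I d m ((1\<^sub>m (d m) - P m) - P m) \<psi> = \<phi>"
      using local_apply_minus[where d = d, OF fin m minus_carrier_mat[OF projectorD(1)[OF Pm(1)]] projectorD(1)[OF Pm(1)]]
      by (simp add: Pm(2) Rm \<phi>_def)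
    then show ?thesis
      using partial_trace_local_apply_unitary[where d = d, OF fin m reflection_unitary[OF Pm(1)], of \<psi>] by simp
  qed
  have "\<phi> \<in> tensor_space I d"
    using norm_eq[OF P] norm_eq[OF R] by (simp add: \<phi>_def tensor_space_def)
  moreover have "tnorm I d \<phi> = 1"
  proof -
    have "finite (I - {i})" using fin by simp
    then obtain h :: "nat \<Rightarrow> multi_index" and r where h: "bij_betw h {..<r} (multi_indices (I - {i}) d)"
      by (rule ex_multi_indices_enum)
    have "(tnorm I d \<phi>)\<^sup>2 = (tnorm I d \<psi>)\<^sup>2"
      by (simp only: tnorm_partial_trace[OF fin i h] pt[OF i])
    moreover have "tnorm I d \<phi> \<ge> 0" by (simp add: tnorm_def sum_nonneg)
    ultimately show ?thesis using \<psi>(2) by (simp add: power2_eq_1_iff)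
  qed
  ultimately show ?thesis
    using pt overlap unfolding locally_undetermined_def pure_state_def by blast
qed

section \<open>Splitting a locally undetermined state by spectral projectors\<close>

lemma locally_undetermined_imp_splittable:
  assumes fin: "finite I" and pure: "pure_state I d \<psi>" and "locally_undetermined I d \<psi>"
    and two: "\<And>i. i \<in> I \<Longrightarrow> \<exists>m\<in>I. m \<noteq> i" and ne: "I \<noteq> {}"
  shows "splittable I d \<psi>"
proof -
  have \<psi>: "\<psi> \<in> tensor_space I d" "tnorm I d \<psi> = 1" using pure by (auto simp: pure_state_def)
  obtain \<phi> where \<phi>: "\<phi> \<in> tensor_space I d" "tnorm I d \<phi> = 1" "cmod (tinner I d \<phi> \<psi>) \<noteq> 1"
    and pt: "\<And>i. i \<in> I \<Longrightarrow> partial_trace I d i (ketbra \<psi> \<psi>) = partial_trace I d i (ketbra \<phi> \<phi>)"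
    using assms(3) unfolding locally_undetermined_def pure_state_def by blast
  have "\<exists>W. W \<in> carrier_mat (d i) (d i) \<and> normal_mat W \<and> local_apply I d i W \<psi> = \<phi>"
    if i: "i \<in> I" for i
  proof -
    obtain m where "m \<in> I" "m \<noteq> i" using two[OF i] by blast
    then show ?thesis
      using ex_normal_local_apply_eq[OF fin i _ _ \<psi>(1) \<phi>(1) pt[OF i] pt] by metis
  qed
  then obtain W where W: "\<And>i. i \<in> I \<Longrightarrow> W i \<in> carrier_mat (d i) (d i)"
    and nor: "\<And>i. i \<in> I \<Longrightarrow> normal_mat (W i)"
    and W\<psi>: "\<And>i. i \<in> I \<Longrightarrow> local_apply I d i (W i) \<psi> = \<phi>"
    by metis
  define E where "E = (\<lambda>i p. mat_poly (d i) (W i) p)"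
  have E: "E i p \<in> carrier_mat (d i) (d i)" if "i \<in> I" for i p
    unfolding E_def using W[OF that] by simp
  \<comment> \<open>In the induction step \<open>W i\<close> is moved past the operator of m,
    replaced on \<psi> by \<open>W m\<close>, as both give \<phi>, and \<open>W m\<close> is moved
    back.\<close>
  have E_agree: "local_apply I d i (E i p) \<psi> = local_apply I d m (E m p) \<psi>"
    if i: "i \<in> I" and m: "m \<in> I" for i m p
  proof (cases "i = m")
    case False
    show ?thesis
    proof (induction p)
      case 0
      then show ?case using local_apply_zero[OF fin i] local_apply_zero[OF fin m] by (simp add: E_def)
    next
      case (pCons c p)
      have comm: "E m p * W m = W m * E m p"
        unfolding E_def by (rule mat_poly_commute[OF W[OF m] W[OF m] refl])
      have step: "local_apply I d j (E j (pCons c p)) \<psi>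
          = (\<lambda>k. c * \<psi> k + local_apply I d j (W j) (local_apply I d j (E j p) \<psi>) k)" if j: "j \<in> I" for j
        unfolding local_apply_mult[where d = d, OF fin j W[OF j] E[OF j]]
        unfolding E_def mat_poly_pCons[OF W[OF j]]
        by (rule local_apply_scalar_plus[where d = d, OF fin j mult_carrier_mat[OF W[OF j] mat_poly_carrier[OF W[OF j]]] \<psi>(1)])
      have "local_apply I d i (W i) (local_apply I d i (E i p) \<psi>)
          = local_apply I d i (W i) (local_apply I d m (E m p) \<psi>)"
        by (simp only: pCons.IH)
      also have "\<dots> = local_apply I d m (E m p) (local_apply I d i (W i) \<psi>)"
        by (rule local_apply_commute[where d = d, OF fin False W[OF i] E[OF m]])
      also have "\<dots> = local_apply I d m (E m p) (local_apply I d m (W m) \<psi>)"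
        by (simp only: W\<psi>[OF i] W\<psi>[OF m])
      also have "\<dots> = local_apply I d m (W m) (local_apply I d m (E m p) \<psi>)"
        by (simp only: local_apply_mult[where d = d, OF fin m E[OF m] W[OF m]]
            local_apply_mult[where d = d, OF fin m W[OF m] E[OF m]] comm)
      finally show ?case by (simp only: step[OF i] step[OF m])
    qed
  qed simp
  have "\<exists>\<Lambda>. finite \<Lambda> \<and> (\<forall>p. (\<forall>x\<in>\<Lambda>. poly p x = 0) \<longrightarrow> E i p = 0\<^sub>m (d i) (d i))" if "i \<in> I" for i
    using normal_mat_poly_eq_0[OF W[OF that] nor[OF that]] unfolding E_def by metis
  then obtain L where L: "\<And>i. i \<in> I \<Longrightarrow> finite (L i)"
    "\<And>i p. i \<in> I \<Longrightarrow> (\<forall>x\<in>L i. poly p x = 0) \<Longrightarrow> E i p = 0\<^sub>m (d i) (d i)"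
    by metis
  \<comment> \<open>One finite set serves all agents, so that the interpolating polynomials do not
    depend on the agent.\<close>
  define \<Lambda> where "\<Lambda> = (\<Union>i\<in>I. L i)"
  have fin\<Lambda>: "finite \<Lambda>" using fin L(1) by (auto simp: \<Lambda>_def)
  have zero: "E i p = 0\<^sub>m (d i) (d i)" if "i \<in> I" "\<And>x. x \<in> \<Lambda> \<Longrightarrow> poly p x = 0" for i p
    using L(2)[OF that(1)] that by (auto simp: \<Lambda>_def)
  have cong: "E i p = E i q" if i: "i \<in> I" and "\<And>x. x \<in> \<Lambda> \<Longrightarrow> poly p x = poly q x" for i p q
  proof -
    have "E i (p - q) = 0\<^sub>m (d i) (d i)" using that by (intro zero) auto
    then have "E i p - E i q = 0\<^sub>m (d i) (d i)"
      unfolding E_def by (simp only: mat_poly_diff[OF W[OF i]])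
    then show ?thesis by (rule minus_mat_eq_0D[OF E[OF i] E[OF i]])
  qed
  have "\<exists>p. \<forall>x\<in>\<Lambda>. poly p x = (if x = y then 1 else 0)" for y
    by (rule ex_interpolating_poly[OF fin\<Lambda>])
  \<comment> \<open>On \<Lambda>, \<open>F y\<close> is the indicator of y. Hence
    \<open>E i (F y)\<close> plays the role of the spectral projector of \<open>W i\<close> at y and
    is zero if y is no eigenvalue.\<close>
  then obtain F where F: "\<And>x y. x \<in> \<Lambda> \<Longrightarrow> poly (F y) x = (if x = y then 1 else 0)"
    by metis
  obtain i where i: "i \<in> I" using ne by blast
  define \<chi> where "\<chi> = (\<lambda>x. local_apply I d i (E i (F x)) \<psi>)"
  have agreeing: "agreeing_projections I d \<psi> (\<lambda>m. E m (F x)) (\<chi> x)" for x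
    unfolding agreeing_projections_def
  proof (intro ballI conjI)
    fix m assume m: "m \<in> I"
    \<comment> \<open>\<open>F x\<close> and its square have the same values on \<Lambda>, which
      makes the matrix idempotent; being normal too, it is Hermitian.\<close>
    have "E m (F x) * E m (F x) = E m (F x * F x)"
      unfolding E_def by (simp only: mat_poly_mult[OF W[OF m]])
    also have "\<dots> = E m (F x)" by (rule cong[OF m]) (simp add: F)
    finally have idem: "E m (F x) * E m (F x) = E m (F x)" .
    then show "projector (d m) (E m (F x))"
      unfolding projector_def
      using E[OF m] normal_idempotent_hermitian[OF E[OF m] _ idem] normal_mat_poly[OF W[OF m] nor[OF m]]
      by (simp add: E_def)
    show "local_apply I d m (E m (F x)) \<psi> = \<chi> x"
      unfolding \<chi>_def by (rule E_agree[OF m i])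
  qed
  have "\<exists>x\<in>\<Lambda>. \<chi> x \<noteq> (\<lambda>k. 0) \<and> \<chi> x \<noteq> \<psi>"
  proof (rule ccontr)
    assume "\<not> ?thesis"
    then consider x where "x \<in> \<Lambda>" "\<chi> x = \<psi>" | "\<And>x. x \<in> \<Lambda> \<Longrightarrow> \<chi> x = (\<lambda>k. 0)" by blast
    then show False
    proof cases
      case (1 x)
      \<comment> \<open>If one component is all of \<psi>, then \<phi> = x \<psi>, because t times
        \<open>F x\<close> and x times \<open>F x\<close> agree as functions of t on \<Lambda>.
        Normalisation gives x modulus 1, against the assumption on the overlap.\<close>
      have "\<phi> = local_apply I d i (W i) (local_apply I d i (E i (F x)) \<psi>)"
        using 1(2) W\<psi>[OF i] by (simp add: \<chi>_def)
      also have "\<dots> = local_apply I d i (W i * E i (F x)) \<psi>"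
        by (rule local_apply_mult[where d = d, OF fin i W[OF i] E[OF i]])
      also have "W i * E i (F x) = E i ([:0, 1:] * F x)"
        unfolding E_def by (simp only: mat_poly_mult[OF W[OF i]] mat_poly_X[OF W[OF i]])
      also have "\<dots> = E i (Polynomial.smult x (F x))"
        by (rule cong[OF i]) (auto simp: F)
      also have "\<dots> = x \<cdot>\<^sub>m E i (F x)"
        unfolding E_def by (rule mat_poly_smult[OF W[OF i]])
      also have "local_apply I d i \<dots> \<psi> = (\<lambda>k. x * \<psi> k)"
        using local_apply_smult[where d = d, OF fin i E[OF i], of x "F x" \<psi>] 1(2) by (simp add: \<chi>_def)
      finally have \<phi>x: "\<phi> = (\<lambda>k. x * \<psi> k)" .
      then have "cmod x = 1" using \<phi>(2) \<psi>(2) by (simp add: tnorm_cmult)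
      moreover have "tinner I d \<phi> \<psi> = cnj x"
        unfolding \<phi>x tinner_cmult_left tinner_self \<psi>(2) by simp
      ultimately show False using \<phi>(3) by simp
    next
      case 2
      \<comment> \<open>The polynomials \<open>F x\<close> add up to 1 on \<Lambda>, so if all
        components vanished, \<psi> would be zero.\<close>
      have "local_apply I d i (E i (\<Sum>x\<in>S. F x)) \<psi> = (\<lambda>k. 0)" if "finite S" "S \<subseteq> \<Lambda>" for S
        using that
      proof (induction S rule: finite_induct)
        case empty
        then show ?case using local_apply_zero[OF fin i] by (simp add: E_def)
      next
        case (insert x S)
        have "E i (\<Sum>x\<in>insert x S. F x) = E i (F x) + E i (\<Sum>x\<in>S. F x)"
          unfolding E_def sum.insert[OF insert.hyps] by (rule mat_poly_add[OF W[OF i]])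
        then show ?case
          using local_apply_add[where d = d, OF fin i E[OF i] E[OF i]] insert 2[of x] by (simp add: \<chi>_def)
      qed
      then have "local_apply I d i (E i (\<Sum>x\<in>\<Lambda>. F x)) \<psi> = (\<lambda>k. 0)" using fin\<Lambda> by blast
      also have "E i (\<Sum>x\<in>\<Lambda>. F x) = E i 1"
        by (rule cong[OF i]) (simp add: poly_sum F sum.delta'[OF fin\<Lambda>])
      also have "E i 1 = 1\<^sub>m (d i)" unfolding E_def by (rule mat_poly_1[OF W[OF i]])
      finally have "\<psi> = (\<lambda>k. 0)" using local_apply_one[OF fin \<psi>(1) i] by simp
      then show False using \<psi>(2) by (simp add: tnorm_def)
    qed
  qed
  then show ?thesis using agreeing unfolding splittable_def by blast
qed

theorem theorem4:
  fixes n :: nat and d :: "nat \<Rightarrow> nat" and \<psi> :: "(nat \<Rightarrow> nat) \<Rightarrow> complex"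
  assumes "n \<ge> 2"
    and "pure_state {1..n} d \<psi>"
  shows "((\<exists>(J :: nat set) (Q :: nat \<Rightarrow> nat \<Rightarrow> complex mat).
              totally_correct_consensus {1..n} d \<psi> J Q)
            \<longleftrightarrow> locally_undetermined {1..n} d \<psi>)
         \<and> (locally_undetermined {1..n} d \<psi> \<longleftrightarrow> GSD {1..n} d \<psi>)"
proof -
  let ?I = "{1..n}"
  have fin: "finite ?I" and ne: "?I \<noteq> {}" using assms(1) by auto
  have sp: "\<psi> \<in> tensor_space ?I d" using assms(2) by (simp add: pure_state_def)
  \<comment> \<open>Here n >= 2 enters: each agent is given a partner, whose partial trace supplies
    the second Gram matrix.\<close>
  have two: "\<exists>m\<in>?I. m \<noteq> i" if "i \<in> ?I" for i
  proof (cases "i = 1")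
    case True
    then show ?thesis using assms(1) by (intro bexI[of _ 2]) auto
  next
    case False
    then show ?thesis using assms(1) by (intro bexI[of _ 1]) auto
  qed
  have "locally_undetermined ?I d \<psi> \<longleftrightarrow> splittable ?I d \<psi>"
    using splittable_imp_locally_undetermined[OF fin ne assms(2)]
      locally_undetermined_imp_splittable[OF fin assms(2) _ two ne] by blast
  moreover have "GSD ?I d \<psi> \<longleftrightarrow> splittable ?I d \<psi>"
    using GSD_imp_splittable[OF fin _ ne] splittable_imp_GSD[OF fin _ sp ne] by blast
  moreover have "(\<exists>(J :: nat set) Q. totally_correct_consensus ?I d \<psi> J Q) \<longleftrightarrow> splittable ?I d \<psi>"
    using consensus_imp_splittable[OF fin _ sp ne] splittable_imp_consensus[OF fin _ sp ne] by blast
  ultimately show ?thesis by blast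
qed

end
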